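(* Under Assumptions 1 and 2, with $\hat\theta_T$ the estimator output by the dual active reward learning algorithm, $$M(\xi_T,\hat\theta_T)\xrightarrow{a.s.}M(\xi_*,\theta_* )\quad\text{as }T\to\infty.$$
   Context: Let $\mu(w)=1/(1+e^{-w})$ and $\dot\mu(w)=\mu(w)(1-\mu(w))$. Fix $d\ge1$, a compact parameter set $\Theta\subset\mathbb R^d$ containing the true unknown parameter $\theta_*$, and a known feature map $\phi:\mathcal X\times\mathcal A\to\mathbb R^d$ (contexts $\mathcal X$, actions $\mathcal A$). A finite candidate set $\mathcal Z=\{z^{(1)},\dots,z^{(n)}\}\subset\mathbb R^d$ is given, where $z^{(i)}=\phi(x^{(i)},a^{(1,i)})-\phi(x^{(i)},a^{(0,i)})$ for a prompt $x^{(i)}$ and two completions, and each $z\in\mathcal Z$ carries a category $k(z)\in\{1,\dots,g\}$. There are $m$ teachers; teacher $j$ has rationality $\beta^{(k)}_j>0$ on category $k$; $\mathcal B_k=\{\beta^{(k)}_1,\dots,\beta^{(k)}_m\}$, $\mathcal B=\bigcup_k\mathcal B_k$. Querying a teacher of rationality $\beta$ on $z$ returns $y\in\{0,1\}$ with $P(y=1)=\mu(\beta\theta_*^\top z)$. Dual active reward learning algorithm: start from initial pairs $(z_1,\beta_1),\dots,(z_{t_0},\beta_{t_0})$ with observed responses and an estimate $\hat\theta_{t_0}$. For $t=t_0+1,\dots,T$: let $H_{t-1}(\theta)=\sum_{s=1}^{t-1}\dot\mu(\beta_s\theta^\top z_s)\beta_s^2z_sz_s^\top$; choose $(z_t,\beta_t)\in\arg\max_{z\in\mathcal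 Z,\ \beta\in\mathcal B_{k(z)}}\det\big[H_{t-1}(\hat\theta_{t-1})+\dot\mu(\beta\hat\theta_{t-1}^\top z)\beta^2zz^\top\big]$ (ties broken at random); observe $y_t$, which conditionally on the past and on $(z_t,\beta_t)$ is Bernoulli with success probability $\mu(\beta_t\theta_*^\top z_t)$; set $\hat\theta_t=\arg\max_{\theta\in\Theta}L_t(\theta)$ where $L_t(\theta)=\frac1t\sum_{s=1}^t\{y_s\log\mu(\beta_s\theta^\top z_s)+(1-y_s)\log[1-\mu(\beta_s\theta^\top z_s)]\}$. Output $\hat\theta_T$. $H_T(\theta)$ is defined by the same formula with sum up to $T$. Designs: a design $\xi$ is a probability measure on pairs $(z,\beta)$ with $z\in\mathcal Z$, $\beta\in\mathcal B_{k(z)}$, with information matrix $M(\xi,\theta)=\sum_{(z,\beta)}\xi(z,\beta)\dot\mu(\beta\theta^\top z)\beta^2zz^\top$. $\xi_T$ is the empirical measure of $(z_1,\beta_1),\dots,(z_T,\beta_T)$, so $M(\xi_T,\theta)=\frac1TH_T(\theta)$; $\xi_*$ is a $D$-optimal design, i.e. a maximizer of $\det M(\xi,\theta_* )$ over all designs. The initial pairs are such that $M(\xi_{t_0},\theta)$ is positive definite for every $\theta\in\Theta$. Assumption 1: $M(\xi_*,\theta_* )$ is positive definite. Assumption 2: there are constants $C_\theta,C_\beta,C_\phi>0$ with $\|\theta\|_2\le C_\theta$ for all $\theta\in\Theta$, $|\beta|<C_\beta$ for all $\beta\in\mathcal B$, $\|\phi(x,a)\|_2\le C_\phi$ for all $(x,a)$;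 and $\theta_*$ is identifiable. *)

theory Defs
  imports "HOL-Probability.Probability"
begin

definition mu :: "real \<Rightarrow> real" where
  "mu w = 1 / (1 + exp (- w))"

definition mudot :: "real \<Rightarrow> real" where
  "mudot w = mu w * (1 - mu w)"

definition outer :: "real^'d \<Rightarrow> real^'d^'d" where
  "outer z = (\<chi> i j. z $ i * z $ j)"

definition posdef :: "real^'d^'d \<Rightarrow> bool" where
  "posdef A \<longleftrightarrow> transpose A = A \<and> (\<forall>x. x \<noteq> 0 \<longrightarrow> x \<bullet> (A *v x) > 0)"

definition feasible :: "(real^'d) set \<Rightarrow> (real^'d \<Rightarrow> nat) \<Rightarrow> (nat \<Rightarrow> real set)
    \<Rightarrow> ((real^'d) \<times> real) set" where
  "feasible Z k Bk = {(z, b). z \<in> Z \<and> b \<in> Bk (k z)}"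

definition is_design :: "((real^'d) \<times> real) set \<Rightarrow> ((real^'d) \<times> real \<Rightarrow> real) \<Rightarrow> bool" where
  "is_design Fs \<xi> \<longleftrightarrow> (\<forall>p. 0 \<le> \<xi> p) \<and> (\<forall>p. p \<notin> Fs \<longrightarrow> \<xi> p = 0) \<and> sum \<xi> Fs = 1"

definition info_matrix :: "((real^'d) \<times> real) set \<Rightarrow> ((real^'d) \<times> real \<Rightarrow> real) \<Rightarrow> real^'d
    \<Rightarrow> real^'d^'d" where
  "info_matrix Fs \<xi> \<theta> =
     (\<Sum>p\<in>Fs. (\<xi> p * mudot (snd p * (\<theta> \<bullet> fst p)) * (snd p)^2) *\<^sub>R outer (fst p))"

definition emp_design :: "(nat \<Rightarrow> (real^'d) \<times> real) \<Rightarrow> nat \<Rightarrow> ((real^'d) \<times> real \<Rightarrow> real)" where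
  "emp_design q T p = real (card {s \<in> {1..T}. q s = p}) / real T"

definition Hmat :: "(nat \<Rightarrow> real^'d) \<Rightarrow> (nat \<Rightarrow> real) \<Rightarrow> nat \<Rightarrow> real^'d \<Rightarrow> real^'d^'d" where
  "Hmat z b t \<theta> = (\<Sum>s\<in>{1..t}. (mudot (b s * (\<theta> \<bullet> z s)) * (b s)^2) *\<^sub>R outer (z s))"

definition loglik :: "(nat \<Rightarrow> real^'d) \<Rightarrow> (nat \<Rightarrow> real) \<Rightarrow> (nat \<Rightarrow> real) \<Rightarrow> nat \<Rightarrow> real^'d \<Rightarrow> real" where
  "loglik z b y t \<theta> = (1 / real t) * (\<Sum>s\<in>{1..t}.
      y s * ln (mu (b s * (\<theta> \<bullet> z s))) + (1 - y s) * ln (1 - mu (b s * (\<theta> \<bullet> z s))))"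

end

theory Submission
  imports Defs "HOL-Library.Discrete_Functions"
begin

text \<open>
  The design space is finite, so a strong law for bounded orthogonal variables, applied to each
  design point separately, controls the log-likelihood uniformly in \<open>\<theta>\<close>; after that the argument
  is pathwise.

  Greedy maximisation of the determinant picks, up to a constant factor, the point \<open>p\<close> with the
  largest score \<open>w p * (z p \<bullet> H\<^sup>-\<^sup>1 z p)\<close>. A point already chosen \<open>N\<close> times has score at most \<open>1/N\<close>,
  and scores decrease as \<open>H\<close> grows, so by pigeonhole all scores at time \<open>T\<close> are \<open>O(1/T)\<close>,
  whatever the estimates in \<open>\<Theta>\<close> are. With the strong convexity of the logistic loss and
  Cauchy-Schwarz, \<open>z p \<bullet> th T\<close> then tends to \<open>z p \<bullet> \<theta>star\<close> for every design point, hence the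
  weights converge. The selection therefore becomes asymptotically the exact greedy rule at the true
  parameter, and concavity of \<open>ln det\<close> gives
  \<open>t * \<delta> (t + 1) \<le> (t - 1) * \<delta> t + o(1)\<close> for the gap \<open>\<delta>\<close> to the optimal log-determinant; so
  \<open>\<delta> \<longlonglongrightarrow> 0\<close>. Strict concavity, in the form of a bound at midpoints, turns this into
  convergence of the information matrices.
\<close>

section \<open>Positive definite forms\<close>

lemma symmetric_inner_commute:
  fixes A :: "real^'d^'d"
  assumes "transpose A = A"
  shows "x \<bullet> (A *v y) = y \<bullet> (A *v x)"
  by (metis assms dot_lmul_matrix inner_commute transpose_matrix_vector)

text \<open>The constant is the minimum of the form on the unit sphere, attained by compactness;
  homogeneity of degree two carries the bound to all vectors.\<close>

lemma posdef_coercive: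
  fixes A :: "real^'d^'d"
  assumes "posdef A"
  obtains c where "c > 0" "\<And>x. c * (norm x)\<^sup>2 \<le> x \<bullet> (A *v x)"
proof -
  have cont: "continuous_on (sphere 0 1) (\<lambda>x. x \<bullet> (A *v x))"
    by (intro continuous_intros)
  have "sphere (0::real^'d) 1 \<noteq> {}"
    by (metis norm_axis_1 mem_sphere_0 empty_iff)
  from continuous_attains_inf[OF compact_sphere this cont] obtain u where u: "u \<in> sphere 0 1"
    "\<And>x. x \<in> sphere 0 1 \<Longrightarrow> u \<bullet> (A *v u) \<le> x \<bullet> (A *v x)"
    by blast
  define c where "c = u \<bullet> (A *v u)"
  have "c > 0"
    using assms u(1) unfolding c_def posdef_def by (metis mem_sphere_0 norm_zero zero_neq_one)
  moreover have "c * (norm x)\<^sup>2 \<le> x \<bullet> (A *v x)" for x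
  proof (cases "x = 0")
    case False
    have "c \<le> (x /\<^sub>R norm x) \<bullet> (A *v (x /\<^sub>R norm x))"
      unfolding c_def using False by (intro u(2)) simp
    also have "\<dots> = (x \<bullet> (A *v x)) / (norm x)\<^sup>2"
      by (simp add: matrix_vector_mult_scaleR power2_eq_square divide_inverse mult_ac)
    finally show ?thesis using False by (simp add: field_simps)
  qed simp
  ultimately show ?thesis using that by blast
qed

text \<open>First-order condition in algebraic form: a non-zero linear term would dominate near
  \<open>0\<close> and change sign there.\<close>

lemma linear_coeff_zero:
  fixes a b :: real
  assumes "\<And>s. 0 \<le> a * s\<^sup>2 + b * s"
  shows "b = 0"
proof (rule ccontr)
  assume b: "b \<noteq> 0"
  \<comment> \<open>The sign of \<open>s\<close> is opposite to that of \<open>b\<close>, and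
    \<open>s\<close> is so small that \<open>a * s\<close> is less than half of \<open>b\<close> in
    absolute value; hence \<open>a * s + b\<close> keeps the sign of \<open>b\<close>.\<close>
  define s where "s = - b / (2 * (\<bar>a\<bar> + 1))"
  have "0 \<le> s * (a * s + b)" using assms[of s] by (simp add: power2_eq_square algebra_simps)
  moreover have "a * s + b = b * (2 * \<bar>a\<bar> + 2 - a) / (2 * (\<bar>a\<bar> + 1))"
    by (simp add: s_def field_simps)
  ultimately have "0 \<le> - (b * b) * (2 * \<bar>a\<bar> + 2 - a) / (2 * (\<bar>a\<bar> + 1))\<^sup>2"
    by (simp add: s_def power2_eq_square)
  moreover have "b * b > 0" using b by (metis not_real_square_gt_zero)
  moreover have "2 * \<bar>a\<bar> + 2 - a > 0" by argo
  ultimately show False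
    by (smt (verit) divide_less_0_iff mult_neg_pos zero_less_power)
qed

text \<open>Spectral theorem for a pair of forms, by induction on the dimension. A maximiser
  \<open>v\<close> of the \<open>B\<close>-form on the \<open>A\<close>-unit sphere of
  \<open>S\<close> is a generalised eigenvector, so its \<open>A\<close>-complement in
  \<open>S\<close> is \<open>B\<close>-orthogonal to it as well. The statement ranges over subspaces
  because the induction passes to that complement.\<close>

lemma joint_orthogonal_basis_subspace:
  fixes A B :: "real^'d^'d"
  assumes A: "posdef A" and B: "transpose B = B" and S: "subspace S"
  shows "\<exists>E. finite E \<and> E \<subseteq> S \<and> card E = dim S \<and> (\<forall>u\<in>E. u \<bullet> (A *v u) = 1) \<and>
     (\<forall>u\<in>E. \<forall>v\<in>E. u \<noteq> v \<longrightarrow> u \<bullet> (A *v v) = 0 \<and> u \<bullet> (B *v v) = 0)"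
  using S
proof (induction "dim S" arbitrary: S)
  case 0
  then show ?case by (intro exI[of _ "{}"]) auto
next
  case (Suc n)
  have At: "transpose A = A" using A by (simp add: posdef_def)
  obtain c where c: "c > 0" "\<And>x. c * (norm x)\<^sup>2 \<le> x \<bullet> (A *v x)"
    using posdef_coercive[OF A] by blast
  define K where "K = S \<inter> {x. x \<bullet> (A *v x) = 1}"
  have "closed {x. x \<bullet> (A *v x) = 1}"
    by (intro closed_Collect_eq continuous_intros)
  then have clK: "closed K" unfolding K_def
    using closed_subspace[OF Suc.prems] by blast
  have "bounded K"
  proof (rule boundedI)
    fix x assume "x \<in> K"
    then have "c * (norm x)\<^sup>2 \<le> 1" using c(2)[of x] by (simp add: K_def)
    then have "(norm x)\<^sup>2 \<le> 1 / c" using c(1) by (simp add: field_simps)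
    then show "norm x \<le> sqrt (1 / c)" by (rule real_le_rsqrt)
  qed
  then have compK: "compact K" using clK compact_eq_bounded_closed by blast
  have "S \<noteq> {0}" using Suc.hyps(2) by (auto simp: dim_eq_0)
  then obtain x0 where x0: "x0 \<in> S" "x0 \<noteq> 0"
    using subspace_0[OF Suc.prems] by blast
  have p0: "x0 \<bullet> (A *v x0) > 0" using A x0(2) by (simp add: posdef_def)
  have "(1 / sqrt (x0 \<bullet> (A *v x0))) *\<^sub>R x0 \<in> K"
    using p0 x0(1) Suc.prems
    by (simp add: K_def subspace_scale matrix_vector_mult_scaleR)
  then have "K \<noteq> {}" by blast
  moreover have "continuous_on K (\<lambda>x. x \<bullet> (B *v x))" by (intro continuous_intros)
  ultimately obtain v where v: "v \<in> K" "\<And>x. x \<in> K \<Longrightarrow> x \<bullet> (B *v x) \<le> v \<bullet> (B *v v)"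
    using continuous_attains_sup[OF compK] by metis
  have vS: "v \<in> S" and vA: "v \<bullet> (A *v v) = 1" using v(1) by (auto simp: K_def)
  define l where "l = v \<bullet> (B *v v)"
  have le: "x \<bullet> (B *v x) \<le> l * (x \<bullet> (A *v x))" if "x \<in> S" for x
  proof (cases "x = 0")
    case False
    have p: "x \<bullet> (A *v x) > 0" using A False by (simp add: posdef_def)
    let ?y = "(1 / sqrt (x \<bullet> (A *v x))) *\<^sub>R x"
    have "?y \<in> K" using p that Suc.prems
      by (simp add: K_def subspace_scale matrix_vector_mult_scaleR)
    from v(2)[OF this] show ?thesis using p
      by (simp add: l_def matrix_vector_mult_scaleR field_simps)
  qed simp
  \<comment> \<open>The form \<open>l * A - B\<close> is non-negative on \<open>S\<close> and
    vanishes at \<open>v\<close>. Along \<open>v + s *\<^sub>R x\<close> it is a quadratic in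
    \<open>s\<close> without constant term, so its linear coefficient vanishes.\<close>
  have orth: "x \<bullet> (B *v v) = 0" if "x \<in> S" "x \<bullet> (A *v v) = 0" for x
  proof -
    have "0 \<le> (l * (x \<bullet> (A *v x)) - x \<bullet> (B *v x)) * s\<^sup>2 + (- 2 * (x \<bullet> (B *v v))) * s" for s
    proof -
      have "v + s *\<^sub>R x \<in> S" using vS that Suc.prems by (simp add: subspace_add subspace_scale)
      from le[OF this] show ?thesis
        using symmetric_inner_commute[OF At, of v x] symmetric_inner_commute[OF B, of v x] that(2) vA
        by (simp add: l_def matrix_vector_mult_scaleR matrix_vector_right_distrib inner_add_left
            inner_add_right power2_eq_square algebra_simps)
    qed
    from linear_coeff_zero[OF this] show ?thesis by simp
  qed
  define S' where "S' = {x \<in> S. x \<bullet> (A *v v) = 0}"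
  have sub: "subspace S'" unfolding S'_def using Suc.prems
    by (auto simp: subspace_def inner_add_left)
  have vn: "v \<notin> S'" using vA by (simp add: S'_def)
  \<comment> \<open>Splitting off the \<open>A\<close>-projection onto \<open>v\<close> shows that
    the complement has dimension exactly one less, as the induction requires.\<close>
  have "S \<subseteq> span (insert v S')"
  proof
    fix x assume x: "x \<in> S"
    let ?k = "x \<bullet> (A *v v)"
    have "x - ?k *\<^sub>R v \<in> S'" using x vS Suc.prems vA
      by (simp add: S'_def subspace_diff subspace_scale inner_diff_left)
    then show "x \<in> span (insert v S')" using span_breakdown_eq span_base by blast
  qed
  moreover have "span (insert v S') \<subseteq> S"
    by (rule span_minimal) (use vS Suc.prems in \<open>auto simp: S'_def\<close>)
  ultimately have "S = span (insert v S')" by blast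
  then have "dim S = dim (insert v S')" by (metis dim_span)
  also have "\<dots> = dim S' + 1" using vn sub by (simp add: dim_insert span_eq_iff[THEN iffD2])
  finally have "n = dim S'" using Suc.hyps(2) by simp
  from Suc.hyps(1)[OF this sub] obtain E where E: "finite E" "E \<subseteq> S'" "card E = dim S'"
    "\<forall>u\<in>E. u \<bullet> (A *v u) = 1"
    "\<forall>u\<in>E. \<forall>v\<in>E. u \<noteq> v \<longrightarrow> u \<bullet> (A *v v) = 0 \<and> u \<bullet> (B *v v) = 0" by blast
  have "v \<notin> E" using vn E(2) by blast
  then have "card (insert v E) = dim S" using E(1,3) \<open>n = dim S'\<close> Suc.hyps(2) by simp
  moreover have "u \<bullet> (A *v v) = 0 \<and> u \<bullet> (B *v v) = 0 \<and> v \<bullet> (A *v u) = 0 \<and> v \<bullet> (B *v u) = 0"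
    if "u \<in> E" for u
    using that E(2) orth[of u] symmetric_inner_commute[OF At, of v u]
      symmetric_inner_commute[OF B, of v u] by (auto simp: S'_def)
  ultimately show ?case
    using E vS vA by (intro exI[of _ "insert v E"]) (auto simp: S'_def)
qed

text \<open>The basis is indexed by the coordinate type, so that its members can be the columns of a
  square matrix and determinants become products over \<open>UNIV\<close>.\<close>

lemma simultaneous_diagonalization:
  fixes A B :: "real^'d^'d"
  assumes "posdef A" and "transpose B = B"
  obtains v :: "'d \<Rightarrow> real^'d"
    where "\<And>i j. v i \<bullet> (A *v v j) = (if i = j then 1 else 0)"
      and "\<And>i j. i \<noteq> j \<Longrightarrow> v i \<bullet> (B *v v j) = 0"
proof -
  obtain E where E: "finite E" "card E = dim (UNIV :: (real^'d) set)" "\<forall>u\<in>E. u \<bullet> (A *v u) = 1"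
     "\<forall>u\<in>E. \<forall>v\<in>E. u \<noteq> v \<longrightarrow> u \<bullet> (A *v v) = 0 \<and> u \<bullet> (B *v v) = 0"
    using joint_orthogonal_basis_subspace[OF assms subspace_UNIV] by blast
  have "card E = card (UNIV :: 'd set)" using E(2) by simp
  then obtain v where v: "bij_betw v (UNIV :: 'd set) E"
    using finite_same_card_bij[OF finite E(1)] by metis
  have "v i \<in> E" for i using v by (auto simp: bij_betw_def)
  moreover have "v i \<noteq> v j" if "i \<noteq> j" for i j
    using v that by (auto simp: bij_betw_def inj_def)
  ultimately show ?thesis using E(3,4) by (intro that[of v]) auto
qed

lemma posdef_symmetric: "posdef A \<Longrightarrow> transpose A = A"
  by (simp add: posdef_def)

lemma posdef_orthonormal_basis:
  fixes A :: "real^'d^'d"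
  assumes "posdef A"
  obtains v :: "'d \<Rightarrow> real^'d" where "\<And>i j. v i \<bullet> (A *v v j) = (if i = j then 1 else 0)"
  using simultaneous_diagonalization[OF assms posdef_symmetric[OF assms]] that by metis

text \<open>With the \<open>v i\<close> as columns of \<open>Q\<close>, the hypothesis reads
  \<open>transpose Q ** A ** Q = mat 1\<close>, so the inverse of \<open>A\<close> is
  \<open>Q ** transpose Q\<close>. All three claims are read off from this.\<close>

lemma orthonormal_family:
  fixes A :: "real^'d^'d" and v :: "'d \<Rightarrow> real^'d"
  assumes on: "\<And>i j. v i \<bullet> (A *v v j) = (if i = j then 1 else 0)"
  shows orthonormal_family_det: "det A * (det (\<chi> a i. v i $ a))\<^sup>2 = 1"
    and orthonormal_family_inv: "matrix_inv A *v z = (\<Sum>i\<in>UNIV. (v i \<bullet> z) *\<^sub>R v i)"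
    and orthonormal_family_expand: "(\<Sum>i\<in>UNIV. (v i \<bullet> (A *v z)) *\<^sub>R v i) = z"
proof -
  define Q :: "real^'d^'d" where "Q = (\<chi> a i. v i $ a)"
  have Qz: "Q ** transpose Q *v x = (\<Sum>i\<in>UNIV. (v i \<bullet> x) *\<^sub>R v i)" for x
    unfolding matrix_vector_mul_assoc[symmetric]
    by (simp add: vec_eq_iff Q_def matrix_vector_mult_def transpose_def inner_vec_def mult.commute)
  have one: "transpose Q ** (A ** Q) = mat 1"
  proof -
    have "(transpose Q ** (A ** Q)) $ i $ j = v i \<bullet> (A *v v j)" for i j
      by (simp add: matrix_matrix_mult_def transpose_def Q_def inner_vec_def matrix_vector_mult_def)
    then show ?thesis by (simp add: vec_eq_iff mat_def on)
  qed
  have "det (transpose Q ** (A ** Q)) = 1" by (simp add: one)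
  then show "det A * (det (\<chi> a i. v i $ a))\<^sup>2 = 1"
    by (simp add: det_mul Q_def[symmetric] power2_eq_square mult_ac)
  have "(transpose Q ** A) ** Q = mat 1" using one by (simp add: matrix_mul_assoc)
  then have "Q ** (transpose Q ** A) = mat 1" by (simp add: matrix_left_right_inverse)
  then have L: "(Q ** transpose Q) ** A = mat 1" by (simp add: matrix_mul_assoc)
  then have R: "A ** (Q ** transpose Q) = mat 1" by (simp add: matrix_left_right_inverse)
  \<comment> \<open>\<open>matrix_inv\<close> is a choice operator; it is pinned down by uniqueness
    of two-sided inverses.\<close>
  have "matrix_inv A = Q ** transpose Q"
  proof -
    have "A ** matrix_inv A = mat 1 \<and> matrix_inv A ** A = mat 1"
      unfolding matrix_inv_def by (rule someI[of _ "Q ** transpose Q"]) (use L R in simp)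
    then show ?thesis by (metis R matrix_mul_assoc matrix_mul_lid matrix_mul_rid)
  qed
  then show "matrix_inv A *v z = (\<Sum>i\<in>UNIV. (v i \<bullet> z) *\<^sub>R v i)" using Qz by simp
  have "(\<Sum>i\<in>UNIV. (v i \<bullet> (A *v z)) *\<^sub>R v i) = ((Q ** transpose Q) ** A) *v z"
    by (metis Qz matrix_vector_mul_assoc)
  then show "(\<Sum>i\<in>UNIV. (v i \<bullet> (A *v z)) *\<^sub>R v i) = z" by (simp add: L)
qed

section \<open>Forms of inverse matrices and rank-one updates\<close>

text \<open>The variance function of optimal design theory: the leverage of \<open>z\<close> when
  \<open>A\<close> is the information matrix. It governs the determinant gain of a further
  observation at \<open>z\<close>.\<close>

definition inv_form :: "real^'d^'d \<Rightarrow> real^'d \<Rightarrow> real" where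
  "inv_form A z = z \<bullet> (matrix_inv A *v z)"

lemma inv_form_orthonormal:
  fixes A :: "real^'d^'d" and v :: "'d \<Rightarrow> real^'d"
  assumes "\<And>i j. v i \<bullet> (A *v v j) = (if i = j then 1 else 0)"
  shows "inv_form A z = (\<Sum>i\<in>UNIV. (v i \<bullet> z)\<^sup>2)"
  unfolding inv_form_def orthonormal_family_inv[OF assms]
  by (simp add: inner_sum_right power2_eq_square inner_commute)

text \<open>The coordinates of \<open>x\<close> in the basis \<open>v\<close> are the numbers
  \<open>v i \<bullet> (A *v x)\<close>; the cross terms vanish by \<open>og\<close>.\<close>

lemma diagonal_form_expand:
  fixes A B :: "real^'d^'d" and v :: "'d \<Rightarrow> real^'d"
  assumes on: "\<And>i j. v i \<bullet> (A *v v j) = (if i = j then 1 else 0)"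
    and og: "\<And>i j. i \<noteq> j \<Longrightarrow> v i \<bullet> (B *v v j) = 0"
  shows "x \<bullet> (B *v y) = (\<Sum>i\<in>UNIV. (v i \<bullet> (B *v v i)) * (v i \<bullet> (A *v x)) * (v i \<bullet> (A *v y)))"
proof -
  let ?c = "\<lambda>i. v i \<bullet> (A *v x)" and ?e = "\<lambda>i. v i \<bullet> (A *v y)"
  have "x \<bullet> (B *v y) = (\<Sum>i\<in>UNIV. ?c i *\<^sub>R v i) \<bullet> (B *v (\<Sum>j\<in>UNIV. ?e j *\<^sub>R v j))"
    by (simp add: orthonormal_family_expand[OF on])
  also have "\<dots> = (\<Sum>i\<in>UNIV. \<Sum>j\<in>UNIV. ?c i * ?e j * (v i \<bullet> (B *v v j)))"
    by (subst sum.swap) (simp add: inner_sum_left inner_sum_right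
        linear_sum[OF matrix_vector_mul_linear] matrix_vector_mult_scaleR sum_distrib_left mult_ac)
  also have "\<dots> = (\<Sum>i\<in>UNIV. \<Sum>j\<in>UNIV. if j = i then ?c i * ?e i * (v i \<bullet> (B *v v i)) else 0)"
    using og by (intro sum.cong refl) auto
  finally show ?thesis by (simp add: mult_ac)
qed

text \<open>Congruence by the matrix with columns \<open>v i\<close> turns \<open>A\<close> into the
  identity and \<open>B\<close> into a diagonal matrix, and scales both determinants by the same
  square.\<close>

lemma diagonal_det:
  fixes A B :: "real^'d^'d" and v :: "'d \<Rightarrow> real^'d"
  assumes on: "\<And>i j. v i \<bullet> (A *v v j) = (if i = j then 1 else 0)"
    and og: "\<And>i j. i \<noteq> j \<Longrightarrow> v i \<bullet> (B *v v j) = 0"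
  shows "det B = det A * (\<Prod>i\<in>UNIV. v i \<bullet> (B *v v i))"
proof -
  define Q :: "real^'d^'d" where "Q = (\<chi> a i. v i $ a)"
  have ent: "(transpose Q ** (B ** Q)) $ i $ j = v i \<bullet> (B *v v j)" for i j
    by (simp add: matrix_matrix_mult_def transpose_def Q_def inner_vec_def matrix_vector_mult_def)
  have "det (transpose Q ** (B ** Q)) = (\<Prod>i\<in>UNIV. (transpose Q ** (B ** Q)) $ i $ i)"
    by (rule det_diagonal) (simp add: ent og)
  then have "det B * (det Q)\<^sup>2 = (\<Prod>i\<in>UNIV. v i \<bullet> (B *v v i))"
    by (simp add: ent det_mul power2_eq_square mult_ac)
  moreover have "det A * (det Q)\<^sup>2 = 1" using orthonormal_family_det[OF on] by (simp add: Q_def)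
  ultimately show ?thesis
    by (metis mult.assoc mult.commute mult_1)
qed

text \<open>Dividing each \<open>v i\<close> by the root of its \<open>B\<close>-form makes the
  family \<open>B\<close>-orthonormal.\<close>

lemma inv_form_diagonal:
  fixes A B :: "real^'d^'d" and v :: "'d \<Rightarrow> real^'d"
  assumes on: "\<And>i j. v i \<bullet> (A *v v j) = (if i = j then 1 else 0)"
    and og: "\<And>i j. i \<noteq> j \<Longrightarrow> v i \<bullet> (B *v v j) = 0"
    and pos: "\<And>i. v i \<bullet> (B *v v i) > 0"
  shows "inv_form B z = (\<Sum>i\<in>UNIV. (v i \<bullet> z)\<^sup>2 / (v i \<bullet> (B *v v i)))"
proof -
  define u where "u i = (1 / sqrt (v i \<bullet> (B *v v i))) *\<^sub>R v i" for i
  have "u i \<bullet> (B *v u j) = (if i = j then 1 else 0)" for i j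
    using og[of i j] pos[of i]
    by (cases "i = j") (auto simp: u_def matrix_vector_mult_scaleR)
  from inv_form_orthonormal[OF this] show ?thesis
    using pos by (simp add: u_def power_mult_distrib power_divide less_imp_le)
qed

lemma posdef_det_pos:
  fixes A :: "real^'d^'d"
  assumes "posdef A" shows "det A > 0"
proof -
  obtain v :: "'d \<Rightarrow> real^'d" where "\<And>i j. v i \<bullet> (A *v v j) = (if i = j then 1 else (0::real))"
    using posdef_orthonormal_basis[OF assms] by blast
  from orthonormal_family_det[OF this] have "det A * (det (\<chi> a i. v i $ a))\<^sup>2 > 0" by simp
  then show ?thesis by (simp add: zero_less_mult_iff)
qed

lemma inv_form_nonneg:
  fixes A :: "real^'d^'d"
  assumes "posdef A" shows "inv_form A z \<ge> 0"
proof -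
  obtain v :: "'d \<Rightarrow> real^'d" where "\<And>i j. v i \<bullet> (A *v v j) = (if i = j then 1 else (0::real))"
    using posdef_orthonormal_basis[OF assms] by blast
  from inv_form_orthonormal[OF this] show ?thesis by (simp add: sum_nonneg)
qed

lemma outer_mult: "outer z *v x = (z \<bullet> x) *\<^sub>R z"
  by (simp add: vec_eq_iff outer_def matrix_vector_mult_def inner_vec_def sum_distrib_left mult_ac)

lemma transpose_outer [simp]: "transpose (outer z) = outer z"
  by (simp add: vec_eq_iff outer_def transpose_def mult.commute)

lemma transpose_add: "transpose (A + B) = transpose A + transpose (B :: real^'d^'d)"
  by (simp add: vec_eq_iff transpose_def)

lemma transpose_scaleR: "transpose (c *\<^sub>R A) = c *\<^sub>R transpose (A :: real^'d^'d)"
  by (simp add: vec_eq_iff transpose_def)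

lemma matrix_scaleR_mult: "(c *\<^sub>R A) *v x = c *\<^sub>R (A *v (x :: real^'d))"
  by (simp add: scaleR_matrix_vector_assoc)

text \<open>In a basis diagonalising both \<open>A\<close> and the rank-one term, at most one diagonal entry of the
  latter is non-zero, so the product of the entries \<open>1 + c (v i \<bullet> z)\<^sup>2\<close> collapses to a sum.\<close>

lemma det_rank_one_update:
  fixes A :: "real^'d^'d"
  assumes "posdef A"
  shows "det (A + c *\<^sub>R outer z) = det A * (1 + c * inv_form A z)"
proof (cases "c = 0")
  case False
  have At: "transpose A = A" using assms by (simp add: posdef_def)
  let ?B = "A + c *\<^sub>R outer z"
  have "transpose ?B = ?B" by (simp add: transpose_add transpose_scaleR At)
  from simultaneous_diagonalization[OF assms this] obtain v :: "'d \<Rightarrow> real^'d"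
    where on: "\<And>i j. v i \<bullet> (A *v v j) = (if i = j then 1 else (0::real))"
      and og: "\<And>i j. i \<noteq> j \<Longrightarrow> v i \<bullet> (?B *v v j) = 0" by metis
  have ent: "v i \<bullet> (?B *v v j) = (if i = j then 1 else 0) + c * (v i \<bullet> z) * (v j \<bullet> z)" for i j
    by (simp add: matrix_vector_mult_add_rdistrib matrix_scaleR_mult outer_mult on inner_add_right
        inner_commute)
  have z0: "v i \<bullet> z = 0 \<or> v j \<bullet> z = 0" if "i \<noteq> j" for i j
    using og[OF that] that False by (simp add: ent)
  have "(\<Prod>i\<in>UNIV. v i \<bullet> (?B *v v i)) = 1 + c * (\<Sum>i\<in>UNIV. (v i \<bullet> z)\<^sup>2)"
  proof (cases "\<exists>k. v k \<bullet> z \<noteq> 0")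
    case True
    then obtain k where k: "v k \<bullet> z \<noteq> 0" by blast
    then have o: "v i \<bullet> z = 0" if "i \<noteq> k" for i using z0[OF that] by blast
    have "(\<Prod>i\<in>UNIV. v i \<bullet> (?B *v v i)) = (\<Prod>i\<in>UNIV. if i = k then 1 + c * (v k \<bullet> z)\<^sup>2 else 1)"
      using o by (intro prod.cong refl) (auto simp: ent power2_eq_square)
    moreover have "(\<Sum>i\<in>UNIV. (v i \<bullet> z)\<^sup>2) = (\<Sum>i\<in>UNIV. if i = k then (v k \<bullet> z)\<^sup>2 else 0)"
      using o by (intro sum.cong refl) auto
    ultimately show ?thesis by simp
  qed (simp add: ent)
  then show ?thesis using diagonal_det[OF on og] inv_form_orthonormal[OF on] by simp
qed simp

text \<open>Inversion reverses the order of positive definite matrices; in a basis diagonalising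
  both forms this is a statement about scalars. The factor \<open>r\<close> serves to compare
  matrices built from different weights.\<close>

lemma inv_form_antimono:
  fixes A B :: "real^'d^'d"
  assumes A: "posdef A" and B: "posdef B" and r: "r > 0"
    and le: "\<And>x. r * (x \<bullet> (A *v x)) \<le> x \<bullet> (B *v x)"
  shows "r * inv_form B z \<le> inv_form A z"
proof -
  obtain v :: "'d \<Rightarrow> real^'d" where on: "\<And>i j. v i \<bullet> (A *v v j) = (if i = j then 1 else (0::real))"
      and og: "\<And>i j. i \<noteq> j \<Longrightarrow> v i \<bullet> (B *v v j) = 0"
    using simultaneous_diagonalization[OF A posdef_symmetric[OF B]] by metis
  have ge: "v i \<bullet> (B *v v i) \<ge> r" for i using le[of "v i"] on[of i i] by simp
  then have pos: "v i \<bullet> (B *v v i) > 0" for i using r by (meson less_le_trans)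
  have "r * ((v i \<bullet> z)\<^sup>2 / (v i \<bullet> (B *v v i))) \<le> (v i \<bullet> z)\<^sup>2" for i
    using ge[of i] pos[of i] by (simp add: divide_le_eq mult.commute[of _ "(v i \<bullet> z)\<^sup>2"] mult_left_mono)
  then show ?thesis
    using inv_form_diagonal[OF on og pos, of z] inv_form_orthonormal[OF on, of z]
    by (simp add: sum_distrib_left sum_mono)
qed

text \<open>Cauchy-Schwarz between the \<open>A\<close>-norm and its dual norm. It turns an
  accumulated squared prediction error into a bound at a single design point.\<close>

lemma inv_form_cauchy_schwarz:
  fixes A :: "real^'d^'d"
  assumes A: "posdef A"
  shows "(z \<bullet> x)\<^sup>2 \<le> inv_form A z * (x \<bullet> (A *v x))"
proof -
  obtain v :: "'d \<Rightarrow> real^'d" where on: "\<And>i j. v i \<bullet> (A *v v j) = (if i = j then 1 else (0::real))"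
    using posdef_orthonormal_basis[OF A] by blast
  have "z \<bullet> x = z \<bullet> (\<Sum>i\<in>UNIV. (v i \<bullet> (A *v x)) *\<^sub>R v i)"
    by (simp add: orthonormal_family_expand[OF on])
  also have "\<dots> = (\<Sum>i\<in>UNIV. (v i \<bullet> z) * (v i \<bullet> (A *v x)))"
    by (simp add: inner_sum_right inner_commute mult.commute)
  finally have "(z \<bullet> x)\<^sup>2 \<le> (\<Sum>i\<in>UNIV. (v i \<bullet> z)\<^sup>2) * (\<Sum>i\<in>UNIV. (v i \<bullet> (A *v x))\<^sup>2)"
    using Cauchy_Schwarz_ineq_sum by metis
  moreover have "x \<bullet> (A *v x) = (\<Sum>i\<in>UNIV. (v i \<bullet> (A *v x))\<^sup>2)"
    using diagonal_form_expand[of v A A x x] on by (simp add: power2_eq_square)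
  ultimately show ?thesis by (simp add: inv_form_orthonormal[OF on])
qed

text \<open>Applied to \<open>x = A\<^sup>-\<^sup>1 z\<close>, the hypothesis reads \<open>c q\<^sup>2 \<le> q\<close> with \<open>q = inv_form A z\<close>.\<close>

lemma inv_form_le:
  fixes A :: "real^'d^'d"
  assumes A: "posdef A" and le: "\<And>x. c * (z \<bullet> x)\<^sup>2 \<le> x \<bullet> (A *v x)"
  shows "c * inv_form A z \<le> 1"
proof -
  obtain v :: "'d \<Rightarrow> real^'d" where on: "\<And>i j. v i \<bullet> (A *v v j) = (if i = j then 1 else (0::real))"
    using posdef_orthonormal_basis[OF A] by blast
  let ?x = "matrix_inv A *v z" and ?q = "inv_form A z"
  have "v i \<bullet> (A *v ?x) = v i \<bullet> z" for i
    unfolding orthonormal_family_inv[OF on]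
    by (simp add: linear_sum[OF matrix_vector_mul_linear] matrix_vector_mult_scaleR inner_sum_right on
        if_distrib cong: if_cong)
  then have "?x \<bullet> (A *v ?x) = ?q"
    using diagonal_form_expand[of v A A ?x ?x] on
    by (simp add: power2_eq_square inv_form_orthonormal[OF on])
  then have h: "c * ?q\<^sup>2 \<le> ?q" using le[of ?x] by (simp add: inv_form_def)
  show ?thesis
  proof (cases "?q = 0")
    case False
    then have "?q > 0" using inv_form_nonneg[OF A, of z] by simp
    then show ?thesis using h by (simp add: power2_eq_square)
  qed simp
qed

section \<open>Greedy determinant maximisation\<close>

lemma weighted_outer_bilinear:
  "x \<bullet> ((\<Sum>i\<in>I. c i *\<^sub>R outer (z i)) *v y) = (\<Sum>i\<in>I. c i * (z i \<bullet> x) * (z i \<bullet> y))"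
proof (induction I rule: infinite_finite_induct)
  case (insert i I)
  then show ?case
    by (simp add: matrix_vector_mult_add_rdistrib matrix_scaleR_mult outer_mult inner_add_right
        inner_commute mult_ac)
qed simp_all

lemma weighted_outer_form:
  "x \<bullet> ((\<Sum>i\<in>I. c i *\<^sub>R outer (z i)) *v x) = (\<Sum>i\<in>I. c i * (z i \<bullet> x)\<^sup>2)"
  by (simp add: weighted_outer_bilinear power2_eq_square mult.assoc)

lemma weighted_outer_symmetric:
  "transpose (\<Sum>i\<in>I. c i *\<^sub>R outer (z i)) = (\<Sum>i\<in>I. c i *\<^sub>R outer (z i))"
  by (induction I rule: infinite_finite_induct)
    (simp_all add: transpose_add transpose_scaleR, simp_all add: vec_eq_iff transpose_def)

lemma posdef_mono:
  fixes A B :: "real^'d^'d"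
  assumes "posdef A" "transpose B = B" "r > 0" "\<And>x. r * (x \<bullet> (A *v x)) \<le> x \<bullet> (B *v x)"
  shows "posdef B"
  unfolding posdef_def using assms
  by (metis less_le_trans mult_pos_pos posdef_def)

text \<open>Both sides are the trace of the inverse of \<open>A\<close> times the weighted sum of
  outer products; the right side computes it in an \<open>A\<close>-orthonormal basis.\<close>

lemma inv_form_trace:
  fixes A :: "real^'d^'d" and v :: "'d \<Rightarrow> real^'d"
  assumes on: "\<And>i j. v i \<bullet> (A *v v j) = (if i = j then 1 else 0)"
  shows "(\<Sum>p\<in>I. c p * inv_form A (z p))
    = (\<Sum>i\<in>UNIV. v i \<bullet> ((\<Sum>p\<in>I. c p *\<^sub>R outer (z p)) *v v i))"
  unfolding weighted_outer_form inv_form_orthonormal[OF on]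
  by (simp add: sum_distrib_left inner_commute) (rule sum.swap)

lemma posdef_det_scaleR:
  fixes A :: "real^'d^'d"
  assumes "posdef A"
  shows "det (c *\<^sub>R A) = c ^ CARD('d) * det A"
proof -
  obtain v :: "'d \<Rightarrow> real^'d" where on: "\<And>i j. v i \<bullet> (A *v v j) = (if i = j then 1 else (0::real))"
    using posdef_orthonormal_basis[OF assms] by blast
  have "v i \<bullet> ((c *\<^sub>R A) *v v j) = (if i = j then c else 0)" for i j
    by (simp add: matrix_scaleR_mult on)
  with diagonal_det[OF on, of "c *\<^sub>R A"] show ?thesis by simp
qed

lemma sum_by_value:
  fixes g :: "'p \<Rightarrow> 'a::real_vector"
  assumes "finite I" "finite F" "q ` I \<subseteq> F"
  shows "(\<Sum>s\<in>I. g (q s)) = (\<Sum>p\<in>F. real (card {s\<in>I. q s = p}) *\<^sub>R g p)"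
proof -
  have "(\<Sum>s\<in>I. g (q s)) = (\<Sum>p\<in>F. \<Sum>s\<in>{s\<in>I. q s = p}. g (q s))"
    by (rule sum.group[OF assms, symmetric])
  also have "\<dots> = (\<Sum>p\<in>F. \<Sum>s\<in>{s\<in>I. q s = p}. g p)"
    by (intro sum.cong refl) auto
  finally show ?thesis by (simp add: sum_constant_scaleR)
qed

text \<open>Growth is at most linear with arbitrarily small slope. It is applied to
  \<open>(t - 1) * \<delta> t\<close> for the optimality gap \<open>\<delta>\<close>.\<close>

lemma tendsto_zero_of_small_increments:
  fixes a :: "nat \<Rightarrow> real"
  assumes nn: "\<forall>\<^sub>F t in sequentially. 0 \<le> a t"
    and inc: "\<And>e. e > 0 \<Longrightarrow> \<forall>\<^sub>F t in sequentially. a (Suc t) \<le> a t + e"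
  shows "(\<lambda>t. a t / real t) \<longlonglongrightarrow> 0"
proof (rule order_tendstoI)
  fix y :: real assume "y < 0"
  then show "\<forall>\<^sub>F t in sequentially. y < a t / real t"
    using nn by (auto elim!: eventually_mono intro: less_le_trans)
next
  fix y :: real assume y: "0 < y"
  obtain N where N: "\<And>t. t \<ge> N \<Longrightarrow> a (Suc t) \<le> a t + y / 2"
    using inc[of "y / 2"] y by (auto simp: eventually_sequentially)
  have up: "a (N + k) \<le> a N + real k * (y / 2)" for k
  proof (induction k)
    case (Suc k)
    then show ?case using N[of "N + k"] by (simp add: distrib_right add_divide_distrib)
  qed simp
  have "(\<lambda>t. a N / real t) \<longlonglongrightarrow> 0" by (rule lim_const_over_n)
  then have "\<forall>\<^sub>F t in sequentially. a N / real t < y / 2" 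
    by (rule order_tendstoD) (use y in simp)
  then show "\<forall>\<^sub>F t in sequentially. a t / real t < y"
    using eventually_ge_at_top[of "Suc N"]
  proof eventually_elim
    case (elim t)
    have "a t \<le> a N + real (t - N) * (y / 2)" using up[of "t - N"] elim by simp
    also have "\<dots> \<le> a N + real t * (y / 2)" using y by (simp add: mult_right_mono)
    finally have "a t / real t \<le> a N / real t + y / 2" using elim(2) by (simp add: field_simps)
    then show ?case using elim(1) by linarith
  qed
qed

section \<open>Scores along a greedy sequence\<close>

text \<open>Abstract form of \<open>Hmat\<close>. Features and weights are separate arguments, so
  that the matrix at the estimate and the matrix at the true parameter are two instances over the
  same choices \<open>q\<close>.\<close>

definition wmat :: "('p \<Rightarrow> real^'d) \<Rightarrow> ('p \<Rightarrow> real) \<Rightarrow> (nat \<Rightarrow> 'p) \<Rightarrow> nat \<Rightarrow> real^'d^'d" where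
  "wmat f w q t = (\<Sum>s\<in>{1..t}. w (q s) *\<^sub>R outer (f (q s)))"

lemma wmat_form: "x \<bullet> (wmat f w q t *v x) = (\<Sum>s\<in>{1..t}. w (q s) * (f (q s) \<bullet> x)\<^sup>2)"
  unfolding wmat_def by (rule weighted_outer_form)

lemma wmat_symmetric: "transpose (wmat f w q t) = wmat f w q t"
  unfolding wmat_def by (rule weighted_outer_symmetric)

lemma wmat_Suc: "wmat f w q (Suc t) = wmat f w q t + w (q (Suc t)) *\<^sub>R outer (f (q (Suc t)))"
  by (simp add: wmat_def)

text \<open>\<open>ws\<close> are the weights at the true parameter, \<open>wt t\<close> those at the estimate after \<open>t\<close> rounds.\<close>

locale greedy_design =
  fixes F :: "'p set" and f :: "'p \<Rightarrow> real^'d" and ws :: "'p \<Rightarrow> real"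
    and wt :: "nat \<Rightarrow> 'p \<Rightarrow> real" and q :: "nat \<Rightarrow> 'p" and t0 :: nat and \<kappa> :: real
  assumes fin: "finite F"
    and q_in: "\<And>s. s \<ge> 1 \<Longrightarrow> q s \<in> F"
    and ws_pos: "\<And>p. p \<in> F \<Longrightarrow> ws p > 0"
    and \<kappa>_pos: "\<kappa> > 0"
    and wt_lower: "\<And>t p. t \<ge> t0 \<Longrightarrow> p \<in> F \<Longrightarrow> \<kappa> * ws p \<le> wt t p"
    and wt_upper: "\<And>t p. t \<ge> t0 \<Longrightarrow> p \<in> F \<Longrightarrow> \<kappa> * wt t p \<le> ws p"
    and init: "posdef (wmat f ws q t0)"
    and greedy: "\<And>t p. t \<ge> t0 \<Longrightarrow> p \<in> F \<Longrightarrow>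
      det (wmat f (wt t) q t + wt t p *\<^sub>R outer (f p))
      \<le> det (wmat f (wt t) q t + wt t (q (Suc t)) *\<^sub>R outer (f (q (Suc t))))"
begin

lemma wmat_form_mono:
  assumes "s \<le> t"
  shows "x \<bullet> (wmat f ws q s *v x) \<le> x \<bullet> (wmat f ws q t *v x)"
  unfolding wmat_form
  by (rule sum_mono2) (use assms q_in ws_pos in \<open>auto simp: less_imp_le\<close>)

lemma posdef_wmat: "t \<ge> t0 \<Longrightarrow> posdef (wmat f ws q t)"
  by (rule posdef_mono[OF init wmat_symmetric, of 1]) (simp_all add: wmat_form_mono)

text \<open>By the rank-one formula, the relative determinant gain from one more observation at
  \<open>p\<close> under the true weights.\<close>

abbreviation score :: "nat \<Rightarrow> 'p \<Rightarrow> real" where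
  "score t p \<equiv> ws p * inv_form (wmat f ws q t) (f p)"

lemma score_nonneg: "t \<ge> t0 \<Longrightarrow> p \<in> F \<Longrightarrow> score t p \<ge> 0"
  using inv_form_nonneg[OF posdef_wmat] ws_pos by (simp add: less_imp_le)

lemma score_antimono:
  assumes "t0 \<le> s" "s \<le> t" "p \<in> F"
  shows "score t p \<le> score s p"
proof -
  have "1 * inv_form (wmat f ws q t) (f p) \<le> inv_form (wmat f ws q s) (f p)"
    by (rule inv_form_antimono) (use assms posdef_wmat wmat_form_mono in auto)
  then show ?thesis using ws_pos[OF assms(3)] by (simp add: mult_left_mono)
qed

text \<open>The choice is greedy for the weights \<open>wt t\<close>, while scores use
  \<open>ws\<close>. If the two families agree within factors \<open>r\<close> and \<open>R\<close>,
  then so do the matrices, and inversion reverses the comparison; weight and inverse form each cost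
  a factor \<open>R / r\<close>. For \<open>r\<close> and \<open>R\<close> near \<open>1\<close> the
  rule is almost exact.\<close>

lemma greedy_score:
  assumes t: "t \<ge> t0" and p: "p \<in> F" and r: "0 < r" and R: "0 < R"
    and lo: "\<And>p. p \<in> F \<Longrightarrow> r * ws p \<le> wt t p"
    and up: "\<And>p. p \<in> F \<Longrightarrow> wt t p \<le> R * ws p"
  shows "r\<^sup>2 * score t p \<le> R\<^sup>2 * score t (q (Suc t))"
proof -
  let ?H = "wmat f ws q t" and ?K = "wmat f (wt t) q t" and ?p = "q (Suc t)"
  have pF: "?p \<in> F" by (rule q_in) simp
  have Hpd: "posdef ?H" using posdef_wmat[OF t] .
  have fl: "r * (x \<bullet> (?H *v x)) \<le> x \<bullet> (?K *v x)" for x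
    unfolding wmat_form sum_distrib_left mult.assoc[symmetric]
    by (intro sum_mono mult_right_mono lo) (auto intro: q_in)
  have fu: "x \<bullet> (?K *v x) \<le> R * (x \<bullet> (?H *v x))" for x
    unfolding wmat_form sum_distrib_left mult.assoc[symmetric]
    by (intro sum_mono mult_right_mono up) (auto intro: q_in)
  have Kpd: "posdef ?K" using posdef_mono[OF Hpd wmat_symmetric r fl] .
  have a: "r * inv_form ?K z \<le> inv_form ?H z" for z
    by (rule inv_form_antimono[OF Hpd Kpd r fl])
  have b: "inv_form ?H z \<le> R * inv_form ?K z" for z
  proof -
    have "(1 / R) * inv_form ?H z \<le> inv_form ?K z"
      by (rule inv_form_antimono[OF Kpd Hpd]) (use R fu in \<open>auto simp: field_simps\<close>)
    then show ?thesis using R by (simp add: field_simps)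
  qed
  \<comment> \<open>Both determinants contain the factor \<open>det ?K\<close>; after division the
    greedy rule maximises weight times inverse form.\<close>
  have g: "wt t p * inv_form ?K (f p) \<le> wt t ?p * inv_form ?K (f ?p)"
    using greedy[OF t p] posdef_det_pos[OF Kpd] by (simp add: det_rank_one_update[OF Kpd])
  have Kn: "inv_form ?K z \<ge> 0" and Hn: "inv_form ?H z \<ge> 0" for z
    using inv_form_nonneg Kpd Hpd by blast+
  have wn: "ws p \<ge> 0" "wt t ?p \<ge> 0"
    using ws_pos[OF p] ws_pos[OF pF] lo[OF pF] r
    by (auto simp: less_imp_le) (meson less_imp_le mult_nonneg_nonneg order_trans)
  have "r\<^sup>2 * score t p \<le> r\<^sup>2 * (ws p * (R * inv_form ?K (f p)))"
    by (intro mult_left_mono b wn) simp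
  also have "\<dots> = r * R * ((r * ws p) * inv_form ?K (f p))" by (simp add: power2_eq_square mult_ac)
  also have "\<dots> \<le> r * R * (wt t p * inv_form ?K (f p))"
    using r R by (intro mult_left_mono mult_right_mono lo p Kn) auto
  also have "\<dots> \<le> r * R * (wt t ?p * inv_form ?K (f ?p))"
    using r R by (intro mult_left_mono g) auto
  also have "\<dots> = R * (wt t ?p * (r * inv_form ?K (f ?p)))" by (simp add: mult_ac)
  also have "\<dots> \<le> R * (wt t ?p * inv_form ?H (f ?p))"
    using R by (intro mult_left_mono a wn) auto
  also have "\<dots> \<le> R * ((R * ws ?p) * inv_form ?H (f ?p))"
    using R by (intro mult_left_mono mult_right_mono up pF Hn) auto
  also have "\<dots> = R\<^sup>2 * score t ?p" by (simp add: power2_eq_square mult_ac)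
  finally show ?thesis .
qed

abbreviation count :: "nat \<Rightarrow> 'p \<Rightarrow> nat" where
  "count t p \<equiv> card {s \<in> {1..t}. q s = p}"

text \<open>The visits to \<open>p\<close> alone contribute \<open>count t p * ws p\<close> times
  the outer product of \<open>f p\<close> to the information matrix, which therefore dominates this
  rank-one form.\<close>

lemma count_score_le:
  assumes "t \<ge> t0" "p \<in> F"
  shows "real (count t p) * score t p \<le> 1"
proof -
  have "real (count t p) * ws p * (f p \<bullet> x)\<^sup>2 \<le> x \<bullet> (wmat f ws q t *v x)" for x
  proof -
    have "real (count t p) * ws p * (f p \<bullet> x)\<^sup>2
        = (\<Sum>s\<in>{s\<in>{1..t}. q s = p}. ws (q s) * (f (q s) \<bullet> x)\<^sup>2)" by simp
    also have "\<dots> \<le> (\<Sum>s\<in>{1..t}. ws (q s) * (f (q s) \<bullet> x)\<^sup>2)"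
      by (rule sum_mono2) (use q_in ws_pos in \<open>auto simp: less_imp_le\<close>)
    finally show ?thesis by (simp add: wmat_form)
  qed
  from inv_form_le[OF posdef_wmat[OF assms(1)] this] show ?thesis by (simp add: mult_ac)
qed

lemma count_sum: "(\<Sum>p\<in>F. real (count t p)) = real t"
proof -
  have "(\<Sum>s\<in>{1..t}. (1::real)) = (\<Sum>p\<in>F. real (count t p) *\<^sub>R 1)"
    by (rule sum_by_value[where q=q]) (use fin q_in in auto)
  then show ?thesis by simp
qed

text \<open>Some \<open>p\<close> was chosen at least \<open>T / card F\<close> times; the last time it was chosen, its score,
  maximal up to a constant, was already \<open>O(1/T)\<close>, and scores only decrease.\<close>

lemma score_bound:
  obtains C T1 where "C > 0" "T1 \<ge> t0" "T1 \<ge> 1"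
    "\<And>T p. T \<ge> T1 \<Longrightarrow> p \<in> F \<Longrightarrow> real T * score T p \<le> C"
proof -
  define K where "K = card F"
  have "F \<noteq> {}" using q_in[of 1] by auto
  then have K: "K > 0" using fin by (simp add: K_def card_gt_0_iff)
  \<comment> \<open>The factor \<open>card F\<close> comes from the pigeonhole, \<open>2\<close>
    from discarding the last visit, and the fourth power of \<open>\<kappa>\<close> from the two
    squares in \<open>greedy_score\<close>.\<close>
  define C where "C = 2 * real K / \<kappa> ^ 4"
  \<comment> \<open>Large enough that \<open>T / K\<close> is at least \<open>2 * (t0 + 1)\<close>:
    the last visit then falls after \<open>t0\<close>, and discarding it costs at most half of the
    count.\<close>
  define T1 where "T1 = 2 * K * (t0 + 1)"
  have "C > 0" using K \<kappa>_pos by (simp add: C_def)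
  moreover have "T1 \<ge> t0" "T1 \<ge> 1" using K unfolding T1_def by (cases K; simp)+
  moreover have "real T * score T p' \<le> C" if T: "T \<ge> T1" and p': "p' \<in> F" for T p'
  proof -
    have "\<exists>p\<in>F. real T / real K \<le> real (count T p)"
    proof (rule ccontr)
      assume "\<not> ?thesis"
      then have "(\<Sum>p\<in>F. real (count T p)) < (\<Sum>p\<in>F. real T / real K)"
        using fin \<open>F \<noteq> {}\<close> by (intro sum_strict_mono) auto
      then show False using count_sum[of T] K by (simp add: K_def)
    qed
    then obtain p where p: "p \<in> F" "real T / real K \<le> real (count T p)" by blast
    have "real T \<ge> 2 * real K * (real t0 + 1)"
      using T unfolding T1_def by (metis (mono_tags) of_nat_le_iff of_nat_mult of_nat_add of_nat_1 of_nat_numeral)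
    then have TK: "real T / real K \<ge> 2 * (real t0 + 1)" using K by (simp add: field_simps)
    define S where "S = {s \<in> {1..T}. q s = p}"
    have cS: "real (card S) \<ge> 2 * (real t0 + 1)" using p(2) TK by (simp add: S_def)
    then have "card S > 0" by (metis of_nat_0 less_irrefl not_gr_zero add_pos_nonneg of_nat_0_le_iff
        zero_less_one add.commute mult_pos_pos zero_less_numeral not_le)
    then have S: "finite S" "S \<noteq> {}" by (auto simp: card_gt_0_iff)
    define s where "s = Max S"
    have sS: "s \<in> S" using S by (simp add: s_def)
    have "S \<subseteq> {1..s}" using S by (auto simp: s_def S_def)
    then have "card S \<le> s" using card_mono[of "{1..s}" S] by simp
    then have "real s \<ge> 2 * (real t0 + 1)" using cS by linarith
    then have s: "s - 1 \<ge> t0" "s \<ge> 1" "s \<le> T" using sS by (auto simp: S_def)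
    \<comment> \<open>Round \<open>s\<close> is decided by the scores after \<open>s - 1\<close>
      rounds, when \<open>p\<close> has one visit fewer.\<close>
    define m where "m = s - 1"
    have sm: "s = Suc m" using s by (simp add: m_def)
    have m: "m \<ge> t0" "m \<le> T" "q (Suc m) = p" using s sS by (auto simp: m_def S_def)
    have "S \<subseteq> insert s {s' \<in> {1..m}. q s' = p}"
    proof
      fix x assume x: "x \<in> S"
      then have "x \<le> s" using S by (simp add: s_def)
      then show "x \<in> insert s {s' \<in> {1..m}. q s' = p}" using x by (auto simp: S_def sm)
    qed
    then have "card S \<le> card (insert s {s' \<in> {1..m}. q s' = p})" by (intro card_mono) auto
    also have "\<dots> \<le> Suc (count m p)" by (rule card_insert_le_m1) auto
    finally have "real (count m p) \<ge> real (card S) - 1" by linarith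
    moreover have "real (card S) - 1 \<ge> real T / real K / 2"
    proof -
      have "u / 2 \<le> c - 1" if "u \<le> c" "2 \<le> u" for u c :: real
        using that by (simp add: field_simps)
      moreover have "2 \<le> real T / real K" using TK by (smt (verit) of_nat_0_le_iff)
      ultimately show ?thesis using p(2) by (simp add: S_def)
    qed
    ultimately have cm: "real (count m p) \<ge> real T / real K / 2" by linarith
    have "(real T / real K / 2) * score m p \<le> real (count m p) * score m p"
      by (intro mult_right_mono cm score_nonneg m p)
    also have "\<dots> \<le> 1" by (rule count_score_le[OF m(1) p(1)])
    finally have 1: "real T * score m p \<le> 2 * real K" using K by (simp add: field_simps)
    \<comment> \<open>The point chosen in round \<open>Suc m\<close> is \<open>p\<close>, so its
      score bounds that of every other point at that time, up to a constant.\<close>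
    have "\<kappa>\<^sup>2 * score m p' \<le> (1 / \<kappa>)\<^sup>2 * score m (q (Suc m))"
      by (rule greedy_score[OF m(1) p'])
        (use \<kappa>_pos wt_lower wt_upper m(1) in \<open>auto simp: field_simps\<close>)
    then have 2: "\<kappa> ^ 4 * score m p' \<le> score m p"
      using \<kappa>_pos m(3) by (simp add: field_simps power2_eq_square power4_eq_xxxx)
    have "\<kappa> ^ 4 * (real T * score T p') \<le> real T * (\<kappa> ^ 4 * score m p')"
      unfolding mult.left_commute[of "real T" "\<kappa> ^ 4"]
      by (rule mult_left_mono[OF mult_left_mono[OF score_antimono[OF m(1,2) p']]])
        (use \<kappa>_pos in auto)
    also have "\<dots> \<le> real T * score m p" by (intro mult_left_mono 2) simp
    also note 1
    finally show ?thesis using \<kappa>_pos by (simp add: C_def field_simps)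
  qed
  ultimately show ?thesis using that by blast
qed

end

section \<open>Normalised designs and stability of the maximiser\<close>

definition design_mat :: "'p set \<Rightarrow> ('p \<Rightarrow> real^'d) \<Rightarrow> ('p \<Rightarrow> real) \<Rightarrow> ('p \<Rightarrow> real) \<Rightarrow> real^'d^'d" where
  "design_mat F f w \<xi> = (\<Sum>p\<in>F. (\<xi> p * w p) *\<^sub>R outer (f p))"

lemma design_mat_symmetric: "transpose (design_mat F f w \<xi>) = design_mat F f w \<xi>"
  unfolding design_mat_def by (rule weighted_outer_symmetric)

lemma wmat_eq_design_mat:
  assumes "finite F" and "\<And>s. s \<ge> 1 \<Longrightarrow> q s \<in> F"
  shows "(1 / real t) *\<^sub>R wmat f w q t
    = design_mat F f w (\<lambda>p. real (card {s \<in> {1..t}. q s = p}) / real t)"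
proof -
  have "wmat f w q t = (\<Sum>p\<in>F. real (card {s \<in> {1..t}. q s = p}) *\<^sub>R (w p *\<^sub>R outer (f p)))"
    unfolding wmat_def by (rule sum_by_value[where q=q]) (use assms in auto)
  then show ?thesis by (simp add: design_mat_def scaleR_right.sum)
qed

lemma one_plus_sq_div_ge_1:
  fixes l :: real assumes "l > 0" shows "1 \<le> (1 + l)\<^sup>2 / (4 * l)"
proof -
  have "(1 + l)\<^sup>2 - 4 * l = (1 - l)\<^sup>2" by (simp add: power2_eq_square algebra_simps)
  then have "4 * l \<le> (1 + l)\<^sup>2" by (metis diff_ge_0_iff_ge zero_le_power2)
  then show ?thesis using assms by simp
qed

text \<open>Polarisation at the coordinate vectors recovers each entry of a symmetric matrix from
  its quadratic form.\<close>

lemma quadratic_forms_tendsto_imp_tendsto: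
  fixes M :: "nat \<Rightarrow> real^'d^'d"
  assumes sym: "\<And>t. transpose (M t) = M t" "transpose L = L"
    and lim: "\<And>x. (\<lambda>t. x \<bullet> (M t *v x)) \<longlonglongrightarrow> x \<bullet> (L *v x)"
  shows "M \<longlonglongrightarrow> L"
proof (intro vec_tendstoI)
  fix i j
  have ent: "A $ i $ j = ((axis i 1 + axis j 1) \<bullet> (A *v (axis i 1 + axis j 1))
      - axis i 1 \<bullet> (A *v axis i 1) - axis j 1 \<bullet> (A *v axis j 1)) / 2"
    if "transpose A = A" for A :: "real^'d^'d"
  proof -
    have "axis j 1 \<bullet> (A *v axis i 1) = axis i 1 \<bullet> (A *v axis j 1)"
      by (rule symmetric_inner_commute[OF that])
    moreover have "axis i 1 \<bullet> (A *v axis j 1) = A $ i $ j"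
      by (simp add: inner_axis' matrix_vector_mult_basis column_def)
    ultimately show ?thesis
      by (simp add: matrix_vector_right_distrib inner_add_left inner_add_right)
  qed
  show "(\<lambda>t. M t $ i $ j) \<longlonglongrightarrow> L $ i $ j"
    unfolding ent[OF sym(1)] ent[OF sym(2)] by (intro tendsto_intros lim) simp
qed

text \<open>If the midpoint of \<open>A\<close> and \<open>B\<close> has determinant at most \<open>det A\<close>, the relative eigenvalues
  \<open>l\<close> of \<open>B\<close> satisfy \<open>\<Prod>(1 + l)\<^sup>2 / (4 l) \<le> det A / det B\<close>, where every factor is at least 1.\<close>

lemma det_midpoint_stability:
  fixes A B :: "real^'d^'d"
  assumes A: "posdef A" and B: "posdef B" and mid: "det ((1/2) *\<^sub>R (A + B)) \<le> det A"
    and g: "det A / det B = g" "g \<le> 2"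
  shows "\<bar>x \<bullet> (B *v x) - x \<bullet> (A *v x)\<bar> \<le> sqrt (24 * (g - 1)) * (x \<bullet> (A *v x))"
proof -
  obtain v :: "'d \<Rightarrow> real^'d" where on: "\<And>i j. v i \<bullet> (A *v v j) = (if i = j then 1 else (0::real))"
      and og: "\<And>i j. i \<noteq> j \<Longrightarrow> v i \<bullet> (B *v v j) = 0"
    using simultaneous_diagonalization[OF A posdef_symmetric[OF B]] by metis
  define l where "l i = v i \<bullet> (B *v v i)" for i
  have dA: "det A > 0" by (rule posdef_det_pos[OF A])
  have lpos: "l i > 0" for i
  proof -
    have "v i \<noteq> 0" using on[of i i] by auto
    then show ?thesis using B by (simp add: l_def posdef_def)
  qed
  have detB: "det B = det A * (\<Prod>i\<in>UNIV. l i)" using diagonal_det[OF on og] by (simp add: l_def)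
  have ent: "v i \<bullet> (((1/2) *\<^sub>R (A + B)) *v v j) = (if i = j then (1 + l i) / 2 else 0)" for i j
    using og[of i j] by (simp add: matrix_scaleR_mult matrix_vector_mult_add_rdistrib inner_add_right on l_def)
  have "det ((1/2) *\<^sub>R (A + B)) = det A * (\<Prod>i\<in>UNIV. (1 + l i) / 2)"
    using diagonal_det[OF on, of "(1/2) *\<^sub>R (A + B)"] by (simp add: ent)
  with mid dA have le1: "(\<Prod>i\<in>UNIV. (1 + l i) / 2) \<le> 1" by simp
  have P0: "(\<Prod>i\<in>UNIV. (1 + l i) / 2) \<ge> 0" using lpos by (intro prod_nonneg) (simp add: less_imp_le add_nonneg_nonneg)
  let ?h = "\<lambda>i. (1 + l i)\<^sup>2 / (4 * l i)"
  have h1: "?h i \<ge> 1" for i using one_plus_sq_div_ge_1[OF lpos] .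
  have "(\<Prod>i\<in>UNIV. ?h i) = (\<Prod>i\<in>UNIV. ((1 + l i) / 2)\<^sup>2 / l i)"
    by (intro prod.cong refl) (simp add: power_divide)
  also have "\<dots> = (\<Prod>i\<in>UNIV. (1 + l i) / 2)\<^sup>2 / (\<Prod>i\<in>UNIV. l i)"
    by (simp only: prod_dividef[where g=l] prod_power_distrib)
  also have "\<dots> \<le> 1 / (\<Prod>i\<in>UNIV. l i)"
    using le1 P0 lpos by (intro divide_right_mono) (auto simp: power_le_one prod_nonneg less_imp_le)
  also have "\<dots> = g" using g(1) detB dA by simp
  finally have hg: "(\<Prod>i\<in>UNIV. ?h i) \<le> g" .
  \<comment> \<open>All factors are at least \<open>1\<close>, so each one is bounded by the
    product.\<close>
  have hi: "?h i \<le> g" for i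
  proof -
    have "?h i = ?h i * 1" by simp
    also have "\<dots> \<le> ?h i * (\<Prod>j\<in>UNIV - {i}. ?h j)"
      using h1[of i] by (intro mult_left_mono prod_ge_1 h1) auto
    also have "\<dots> = (\<Prod>i\<in>UNIV. ?h i)" by (simp add: prod.remove[of UNIV i])
    finally show ?thesis using hg by simp
  qed
  have g1: "g \<ge> 1" using hi[of undefined] h1[of undefined] by simp
  \<comment> \<open>The bound on one factor rearranges to
    \<open>(l - 1)^2 \<le> 4 * l * (g - 1)\<close>. With \<open>g \<le> 2\<close> this first gives
    \<open>l \<le> 6\<close>, and inserting that bound gives the constant \<open>24\<close>.\<close>
  have dev: "\<bar>l i - 1\<bar> \<le> sqrt (24 * (g - 1))" for i
  proof -
    have "(1 + l i)\<^sup>2 \<le> g * (4 * l i)" using hi[of i] lpos[of i] by (simp add: divide_le_eq)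
    then have sq: "(l i - 1)\<^sup>2 \<le> 4 * l i * (g - 1)" by (simp add: power2_eq_square algebra_simps)
    also have "\<dots> \<le> 4 * l i * 1" using g(2) lpos[of i] by (intro mult_left_mono) auto
    finally have "(l i)\<^sup>2 \<le> 6 * l i" by (simp add: power2_eq_square algebra_simps)
    then have "l i \<le> 6" using lpos[of i] by (simp add: power2_eq_square)
    then have "4 * l i * (g - 1) \<le> 24 * (g - 1)" using g1 by (intro mult_right_mono) auto
    with sq have "(l i - 1)\<^sup>2 \<le> 24 * (g - 1)" by simp
    then show ?thesis by (metis real_le_rsqrt power2_abs)
  qed
  have xA: "x \<bullet> (A *v x) = (\<Sum>i\<in>UNIV. (v i \<bullet> (A *v x))\<^sup>2)"
    using diagonal_form_expand[of v A A x x] on by (simp add: power2_eq_square)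
  have xB: "x \<bullet> (B *v x) = (\<Sum>i\<in>UNIV. l i * (v i \<bullet> (A *v x))\<^sup>2)"
    using diagonal_form_expand[OF on og, of x x] by (simp add: power2_eq_square l_def mult.assoc)
  have "\<bar>x \<bullet> (B *v x) - x \<bullet> (A *v x)\<bar> = \<bar>\<Sum>i\<in>UNIV. (l i - 1) * (v i \<bullet> (A *v x))\<^sup>2\<bar>"
    by (simp add: xA xB sum_subtractf[symmetric] left_diff_distrib)
  also have "\<dots> \<le> (\<Sum>i\<in>UNIV. \<bar>(l i - 1) * (v i \<bullet> (A *v x))\<^sup>2\<bar>)" by (rule sum_abs)
  also have "\<dots> \<le> (\<Sum>i\<in>UNIV. sqrt (24 * (g - 1)) * (v i \<bullet> (A *v x))\<^sup>2)"
    unfolding abs_mult by (intro sum_mono mult_mono dev) (use g1 in auto)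
  finally show ?thesis
    by (simp add: xA sum_distrib_left)
qed

text \<open>Concavity of \<open>ln det\<close>: the inequality \<open>ln u \<le> u - 1\<close>,
  taken at \<open>u = t * l\<close> for every eigenvalue \<open>l\<close> of the sum relative to
  \<open>A\<close>, and summed. For \<open>A\<close> the matrix after \<open>t\<close> rounds and
  the optimal design as weights, the left side is the dimension plus the optimality gap.\<close>

lemma ln_det_le_trace:
  fixes A :: "real^'d^'d" and c :: "'p \<Rightarrow> real"
  assumes A: "posdef A" and M: "posdef (\<Sum>p\<in>F. c p *\<^sub>R outer (f p))" and t: "t > 0"
  shows "real CARD('d) * (1 + ln t) + ln (det (\<Sum>p\<in>F. c p *\<^sub>R outer (f p))) - ln (det A)
    \<le> t * (\<Sum>p\<in>F. c p * inv_form A (f p))"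
proof -
  let ?M = "\<Sum>p\<in>F. c p *\<^sub>R outer (f p)"
  obtain v :: "'d \<Rightarrow> real^'d" where on: "\<And>i j. v i \<bullet> (A *v v j) = (if i = j then 1 else (0::real))"
      and og: "\<And>i j. i \<noteq> j \<Longrightarrow> v i \<bullet> (?M *v v j) = 0"
    using simultaneous_diagonalization[OF A posdef_symmetric[OF M]] by metis
  define l where "l i = v i \<bullet> (?M *v v i)" for i
  have lpos: "l i > 0" for i
  proof -
    have "v i \<noteq> 0" using on[of i i] by auto
    then show ?thesis using M by (simp add: l_def posdef_def)
  qed
  have "det ?M = det A * (\<Prod>i\<in>UNIV. l i)" using diagonal_det[OF on og] by (simp add: l_def)
  then have ld: "ln (det ?M) = ln (det A) + (\<Sum>i\<in>UNIV. ln (l i))"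
    using posdef_det_pos[OF A] lpos less_imp_neq[OF lpos]
    by (simp add: ln_mult_pos prod_pos ln_prod)
  have "1 + ln t + ln (l i) \<le> t * l i" for i
    using ln_le_minus_one[of "t * l i"] t lpos[of i] by (simp add: ln_mult)
  then have "(\<Sum>i\<in>(UNIV::'d set). 1 + ln t + ln (l i)) \<le> (\<Sum>i\<in>UNIV. t * l i)" by (intro sum_mono)
  then show ?thesis
    using ld inv_form_trace[OF on, where I=F and c=c and z=f] by (simp add: sum.distrib sum_distrib_left l_def algebra_simps)
qed

lemma ln_one_plus_lower:
  fixes s :: real
  assumes "s \<ge> 0"
  shows "s - s\<^sup>2 \<le> ln (1 + s)"
proof -
  have "ln (1 / (1 + s)) \<le> 1 / (1 + s) - 1" using assms by (intro ln_le_minus_one) simp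
  then have "1 - 1 / (1 + s) \<le> ln (1 + s)" using assms by (simp add: ln_div)
  moreover have "(s - s\<^sup>2) * (1 + s) \<le> s" using assms by (simp add: power2_eq_square algebra_simps)
  then have "s - s\<^sup>2 \<le> s / (1 + s)" using assms by (simp add: pos_le_divide_eq)
  moreover have "1 - 1 / (1 + s) = s / (1 + s)" using assms by (simp add: field_simps)
  ultimately show ?thesis by linarith
qed

section \<open>Convergence to the optimal design\<close>

context greedy_design
begin

text \<open>A vertex-direction ascent: round \<open>t + 1\<close> moves the normalised design by a
  fraction \<open>1 / (t + 1)\<close> towards the chosen point. The score bound makes second-order
  terms summably harmless after scaling by \<open>t\<close>, so the gap to the optimum tends to
  zero.\<close>

theorem wmat_tendsto_optimal:
  assumes conv: "\<And>p. p \<in> F \<Longrightarrow> (\<lambda>t. wt t p) \<longlonglongrightarrow> ws p"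
    and \<xi>_nonneg: "\<And>p. p \<in> F \<Longrightarrow> \<xi> p \<ge> 0" and \<xi>_sum: "sum \<xi> F = 1"
    and pd: "posdef (design_mat F f ws \<xi>)"
    and opt: "\<And>\<eta>. (\<And>p. p \<in> F \<Longrightarrow> \<eta> p \<ge> 0) \<Longrightarrow> sum \<eta> F = 1 \<Longrightarrow>
      det (design_mat F f ws \<eta>) \<le> det (design_mat F f ws \<xi>)"
  shows "(\<lambda>t. (1 / real t) *\<^sub>R wmat f ws q t) \<longlonglongrightarrow> design_mat F f ws \<xi>"
proof -
  define d where "d = real CARD('d)"
  define L where "L = design_mat F f ws \<xi>"
  define H where "H t = wmat f ws q t" for t
  define M where "M t = (1 / real t) *\<^sub>R H t" for t
  \<comment> \<open>Difference of the logarithmic determinants of \<open>L\<close> and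
    \<open>M t\<close>; the term \<open>d * ln t\<close> accounts for the normalisation of
    \<open>H t\<close>.\<close>
  define \<delta> where "\<delta> t = ln (det L) + d * ln (real t) - ln (det (H t))" for t
  obtain C T1 where C: "C > 0" "T1 \<ge> t0" "T1 \<ge> 1"
    and sb: "\<And>T p. T \<ge> T1 \<Longrightarrow> p \<in> F \<Longrightarrow> real T * score T p \<le> C"
    using score_bound by blast
  have detL: "det L > 0" using posdef_det_pos[OF pd] by (simp add: L_def)
  have pdH: "posdef (H t)" if "t \<ge> T1" for t using posdef_wmat that C by (simp add: H_def)
  have pdM: "posdef (M t)" if "t \<ge> T1" for t
    by (rule posdef_mono[OF pdH[OF that], of _ "1 / real t"])
      (use that C(3) pdH[OF that] in \<open>auto simp: M_def transpose_scaleR matrix_scaleR_mult posdef_def\<close>)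
  have ratio: "det L / det (M t) = exp (\<delta> t)" if "t \<ge> T1" for t
  proof -
    have "det (M t) = (1 / real t) ^ CARD('d) * det (H t)"
      unfolding M_def by (rule posdef_det_scaleR[OF pdH[OF that]])
    then have "ln (det (M t)) = ln (det (H t)) - d * ln (real t)"
      using posdef_det_pos[OF pdH[OF that]] that C(3)
      by (simp add: ln_mult ln_realpow ln_div d_def)
    then have "\<delta> t = ln (det L) - ln (det (M t))" by (simp add: \<delta>_def)
    then show ?thesis using detL posdef_det_pos[OF pdM[OF that]] by (simp add: exp_diff)
  qed
  have emp: "M t = design_mat F f ws (\<lambda>p. real (count t p) / real t)" for t
    unfolding M_def H_def by (rule wmat_eq_design_mat[OF fin q_in])
  have emp_sum: "(\<Sum>p\<in>F. real (count t p) / real t) = 1" if "t \<ge> T1" for t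
    using count_sum[of t] that C(3) by (simp add: sum_divide_distrib[symmetric])
  \<comment> \<open>The empirical design is itself a competitor of the optimal one.\<close>
  have \<delta>_nonneg: "\<delta> t \<ge> 0" if "t \<ge> T1" for t
  proof -
    have "det (M t) \<le> det L"
      unfolding emp L_def by (rule opt) (use emp_sum[OF that] in auto)
    then have "1 \<le> det L / det (M t)" using posdef_det_pos[OF pdM[OF that]] by simp
    then show ?thesis by (simp add: ratio[OF that])
  qed
  \<comment> \<open>Normalisation adds at most \<open>d / t\<close> to the gap, and the chosen point
    with score \<open>s\<close> removes \<open>ln (1 + s)\<close>. As \<open>t * s\<close> is at
    least \<open>d + \<delta> t - e / 2\<close>, the dimension cancels and the gap shrinks by a
    fraction \<open>1 / t\<close>, up to an error.\<close>
  have step: "\<forall>\<^sub>F t in sequentially. real t * \<delta> (Suc t) \<le> (real t - 1) * \<delta> t + e" if e: "e > 0" for e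
  proof -
    \<comment> \<open>Relative error allowed in the weights. The cap \<open>1/2\<close> keeps
      \<open>1 - e1\<close> positive; the other bound makes the loss \<open>4 * e1 * C\<close> at
      most \<open>e / 2\<close>.\<close>
    define e1 where "e1 = min (1/2) (e / (8 * C))"
    have e1: "0 < e1" "e1 < 1" "4 * e1 * C \<le> e / 2"
      using e C(1) by (auto simp: e1_def min_def field_simps)
    have "\<forall>\<^sub>F t in sequentially. (1 - e1) * ws p \<le> wt t p \<and> wt t p \<le> (1 + e1) * ws p" if "p \<in> F" for p
    proof -
      have "\<forall>\<^sub>F t in sequentially. (1 - e1) * ws p < wt t p"
        by (rule order_tendstoD(1)[OF conv[OF that]]) (use e1 ws_pos[OF that] in \<open>simp add: algebra_simps\<close>)
      moreover have "\<forall>\<^sub>F t in sequentially. wt t p < (1 + e1) * ws p"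
        by (rule order_tendstoD(2)[OF conv[OF that]]) (use e1 ws_pos[OF that] in \<open>simp add: algebra_simps\<close>)
      ultimately show ?thesis by eventually_elim auto
    qed
    then have ev: "\<forall>\<^sub>F t in sequentially. \<forall>p\<in>F. (1 - e1) * ws p \<le> wt t p \<and> wt t p \<le> (1 + e1) * ws p"
      using fin by (simp add: eventually_ball_finite_distrib)
    have "(\<lambda>t. C\<^sup>2 / real t) \<longlonglongrightarrow> 0" by (rule lim_const_over_n)
    then have "\<forall>\<^sub>F t in sequentially. C\<^sup>2 / real t < e / 2"
      by (rule order_tendstoD) (use e in simp)
    with ev eventually_ge_at_top[of T1] show ?thesis
    proof eventually_elim
      case (elim t)
      let ?s = "score t (q (Suc t))" and ?t = "real t"
      have t: "t \<ge> T1" "t \<ge> t0" "?t > 0" using elim(2) C by auto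
      have qF: "q (Suc t) \<in> F" by (rule q_in) simp
      have s0: "?s \<ge> 0" by (rule score_nonneg[OF t(2) qF])
      have sC: "?t * ?s \<le> C" by (rule sb[OF t(1) qF])
      \<comment> \<open>Average score under the optimal design; the greedy score dominates every
        score, hence also this average, up to a factor near \<open>1\<close>.\<close>
      define W where "W = (\<Sum>p\<in>F. \<xi> p * score t p)"
      have "?t * W = (\<Sum>p\<in>F. \<xi> p * (?t * score t p))" by (simp add: W_def sum_distrib_left mult_ac)
      also have "\<dots> \<le> (\<Sum>p\<in>F. \<xi> p * C)" by (intro sum_mono mult_left_mono sb t \<xi>_nonneg)
      finally have WC: "?t * W \<le> C" by (simp add: sum_distrib_right[symmetric] \<xi>_sum)
      have W0: "W \<ge> 0" unfolding W_def by (intro sum_nonneg mult_nonneg_nonneg \<xi>_nonneg score_nonneg t)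
      have "(1 - e1)\<^sup>2 * score t p \<le> (1 + e1)\<^sup>2 * ?s" if "p \<in> F" for p
        by (rule greedy_score[OF t(2) that]) (use elim(1) e1 in auto)
      then have "(\<Sum>p\<in>F. \<xi> p * ((1 - e1)\<^sup>2 * score t p)) \<le> (\<Sum>p\<in>F. \<xi> p * ((1 + e1)\<^sup>2 * ?s))"
        by (intro sum_mono mult_left_mono \<xi>_nonneg)
      then have WS: "(1 - e1)\<^sup>2 * W \<le> (1 + e1)\<^sup>2 * ?s"
        by (simp add: W_def sum_distrib_right[symmetric] \<xi>_sum sum_distrib_left mult_ac)
      have "(1 - 4 * e1) * (1 + e1)\<^sup>2 \<le> (1 - e1)\<^sup>2"
      proof -
        have "(1 - e1)\<^sup>2 - (1 - 4 * e1) * (1 + e1)\<^sup>2 = 8 * e1\<^sup>2 + 4 * e1 ^ 3"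
          by (simp add: power2_eq_square power3_eq_cube algebra_simps)
        moreover have "8 * e1\<^sup>2 + 4 * e1 ^ 3 \<ge> 0" using e1 by simp
        ultimately show ?thesis by linarith
      qed
      then have "(1 - 4 * e1) * (1 + e1)\<^sup>2 * W \<le> (1 + e1)\<^sup>2 * ?s"
        using mult_right_mono[OF _ W0] WS order_trans by blast
      then have "(1 + e1)\<^sup>2 * ((1 - 4 * e1) * W) \<le> (1 + e1)\<^sup>2 * ?s" by (simp add: mult_ac)
      then have "(1 - 4 * e1) * W \<le> ?s" using e1 by (simp add: mult_le_cancel_left_pos)
      then have "?t * ((1 - 4 * e1) * W) \<le> ?t * ?s" by (intro mult_left_mono) auto
      then have sW: "?t * W - 4 * e1 * (?t * W) \<le> ?t * ?s" by (simp add: algebra_simps)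
      have "4 * e1 * (?t * W) \<le> 4 * e1 * C" using e1 WC by (intro mult_left_mono) auto
      with sW e1(3) have sW2: "?t * W - e / 2 \<le> ?t * ?s" by linarith
      have "d * (1 + ln ?t) + ln (det L) - ln (det (H t)) \<le> ?t * W"
        using ln_det_le_trace[OF pdH[OF t(1)], where c="\<lambda>p. \<xi> p * ws p" and F=F and f=f and t="?t"] pd t(3)
        by (simp add: L_def design_mat_def d_def W_def H_def mult.assoc)
      then have "d + \<delta> t \<le> ?t * W" by (simp add: \<delta>_def algebra_simps)
      with sW2 have ts: "d + \<delta> t - e / 2 \<le> ?t * ?s" by linarith
      have "H (Suc t) = H t + ws (q (Suc t)) *\<^sub>R outer (f (q (Suc t)))" by (simp add: H_def wmat_Suc)
      then have "det (H (Suc t)) = det (H t) * (1 + ?s)"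
        using det_rank_one_update[OF pdH[OF t(1)]] by (simp add: H_def)
      then have lnH: "ln (det (H (Suc t))) = ln (det (H t)) + ln (1 + ?s)"
        using posdef_det_pos[OF pdH[OF t(1)]] s0 by (simp add: ln_mult)
      have lns: "?s - ?s\<^sup>2 \<le> ln (1 + ?s)" using ln_one_plus_lower[OF s0] .
      have lnt: "ln (real (Suc t)) - ln ?t \<le> 1 / ?t"
      proof -
        have "ln (real (Suc t) / ?t) \<le> real (Suc t) / ?t - 1" using t(3) by (intro ln_le_minus_one) simp
        then show ?thesis using t(3) by (simp add: ln_div field_simps)
      qed
      have "\<delta> (Suc t) = \<delta> t + d * (ln (real (Suc t)) - ln ?t) - ln (1 + ?s)"
        by (simp add: \<delta>_def lnH algebra_simps)
      also have "\<dots> \<le> \<delta> t + d * (1 / ?t) - (?s - ?s\<^sup>2)"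
        by (intro diff_mono add_left_mono mult_left_mono lnt lns) (simp add: d_def)
      finally have "?t * \<delta> (Suc t) \<le> ?t * (\<delta> t + d * (1 / ?t) - (?s - ?s\<^sup>2))"
        by (intro mult_left_mono) auto
      also have "\<dots> = ?t * \<delta> t + d - ?t * ?s + ?t * ?s\<^sup>2" using t(3) by (simp add: field_simps)
      \<comment> \<open>Only here is the remainder of the logarithm controlled: \<open>t * s\<close>
        is bounded by \<open>C\<close>, so \<open>t * s^2\<close> is of order
        \<open>1 / t\<close>.\<close>
      also have "?t * ?s\<^sup>2 \<le> e / 2"
      proof -
        have "(?t * ?s)\<^sup>2 \<le> C\<^sup>2" using sC s0 t(3) by (intro power_mono) auto
        then have "?t * ?s\<^sup>2 \<le> C\<^sup>2 / ?t" using t(3) by (simp add: field_simps power2_eq_square)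
        then show ?thesis using elim(3) by linarith
      qed
      finally show ?case using ts by (simp add: algebra_simps)
    qed
  qed
  \<comment> \<open>The inequality \<open>step\<close> bounds the increments of
    \<open>(t - 1) * \<delta> t\<close>, whose value at \<open>Suc t\<close> is
    \<open>t * \<delta> (Suc t)\<close>.\<close>
  have "(\<lambda>t. (real t - 1) * \<delta> t / real t) \<longlonglongrightarrow> 0" (is "?D \<longlonglongrightarrow> 0")
  proof (rule tendsto_zero_of_small_increments)
    show "\<forall>\<^sub>F t in sequentially. 0 \<le> (real t - 1) * \<delta> t"
      using eventually_ge_at_top[of T1] by eventually_elim (use \<delta>_nonneg C(3) in auto)
    show "\<forall>\<^sub>F t in sequentially. (real (Suc t) - 1) * \<delta> (Suc t) \<le> (real t - 1) * \<delta> t + e"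
      if "e > 0" for e
      using step[OF that] by simp
  qed
  then have "(\<lambda>t. 2 * ?D t) \<longlonglongrightarrow> 0" by (rule tendsto_mult_right_zero)
  moreover have "\<forall>\<^sub>F t in sequentially. norm (\<delta> t) \<le> 2 * ((real t - 1) * \<delta> t / real t)"
    using eventually_ge_at_top[of "max T1 2"]
  proof eventually_elim
    case (elim t)
    then have "\<delta> t \<ge> 0" "real t \<ge> 2" using \<delta>_nonneg by auto
    then have "real t * \<delta> t \<le> (2 * (real t - 1)) * \<delta> t" by (intro mult_right_mono) auto
    then show ?case using \<open>\<delta> t \<ge> 0\<close> \<open>real t \<ge> 2\<close> by (simp add: field_simps)
  qed
  ultimately have \<delta>_lim: "\<delta> \<longlonglongrightarrow> 0"
    by (rule Lim_null_comparison[rotated])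
  have symM: "transpose (M t) = M t" for t
    by (simp add: M_def H_def transpose_scaleR wmat_symmetric)
  have form: "(\<lambda>t. x \<bullet> (M t *v x)) \<longlonglongrightarrow> x \<bullet> (L *v x)" for x
  proof -
    have "(\<lambda>t. exp (\<delta> t)) \<longlonglongrightarrow> exp 0" by (intro tendsto_intros \<delta>_lim)
    then have ge: "(\<lambda>t. exp (\<delta> t)) \<longlonglongrightarrow> 1" by simp
    then have "(\<lambda>t. sqrt (24 * (exp (\<delta> t) - 1)) * (x \<bullet> (L *v x))) \<longlonglongrightarrow> sqrt (24 * (1 - 1)) * (x \<bullet> (L *v x))"
      by (intro tendsto_intros)
    then have z: "(\<lambda>t. sqrt (24 * (exp (\<delta> t) - 1)) * (x \<bullet> (L *v x))) \<longlonglongrightarrow> 0" by simp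
    have "\<forall>\<^sub>F t in sequentially. exp (\<delta> t) < 2" using order_tendstoD(2)[OF ge] by simp
    then have "\<forall>\<^sub>F t in sequentially. norm (x \<bullet> (M t *v x) - x \<bullet> (L *v x))
        \<le> sqrt (24 * (exp (\<delta> t) - 1)) * (x \<bullet> (L *v x))"
      using eventually_ge_at_top[of T1]
    proof eventually_elim
      case (elim t)
      \<comment> \<open>The midpoint of \<open>L\<close> and \<open>M t\<close> is the information
        matrix of the averaged design, so optimality bounds its determinant by
        \<open>det L\<close>.\<close>
      let ?\<eta> = "\<lambda>p. (1/2) * (\<xi> p + real (count t p) / real t)"
      have "(1/2) *\<^sub>R (L + M t) = design_mat F f ws ?\<eta>"
        unfolding emp L_def design_mat_def sum.distrib[symmetric] scaleR_right.sum
        by (intro sum.cong refl) (simp add: algebra_simps)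
      moreover have "det (design_mat F f ws ?\<eta>) \<le> det L" unfolding L_def
      proof (rule opt)
        show "?\<eta> p \<ge> 0" if "p \<in> F" for p using \<xi>_nonneg[OF that] by simp
        show "sum ?\<eta> F = 1"
          using \<xi>_sum emp_sum[OF elim(2)] by (simp add: sum_divide_distrib[symmetric] sum.distrib)
      qed
      ultimately have mid: "det ((1/2) *\<^sub>R (L + M t)) \<le> det L" by simp
      show ?case
        using det_midpoint_stability[OF pd[folded L_def] pdM[OF elim(2)] mid ratio[OF elim(2)]] elim(1)
        by simp
    qed
    then have "(\<lambda>t. x \<bullet> (M t *v x) - x \<bullet> (L *v x)) \<longlonglongrightarrow> 0"
      using z by (rule Lim_null_comparison)
    then show ?thesis by (simp add: LIM_zero_iff)
  qed
  have "M \<longlonglongrightarrow> L"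
    by (rule quadratic_forms_tendsto_imp_tendsto[OF symM _ form])
      (simp add: L_def design_mat_symmetric)
  then show ?thesis by (simp add: M_def[abs_def] H_def L_def)
qed

end

section \<open>A strong law for bounded orthogonal variables\<close>

text \<open>Between \<open>k^2\<close> and the next square the sum moves by at most
  \<open>2 * k\<close>, which is negligible against \<open>k^2\<close>.\<close>

lemma mean_tendsto_zero_of_squares:
  fixes X :: "nat \<Rightarrow> real"
  assumes bd: "\<And>n. \<bar>X n\<bar> \<le> 1"
    and sub: "(\<lambda>k. (\<Sum>i<k\<^sup>2. X i) / (real k)\<^sup>2) \<longlonglongrightarrow> 0"
  shows "(\<lambda>n. (\<Sum>i<n. X i) / real n) \<longlonglongrightarrow> 0"
proof -
  define S where "S n = (\<Sum>i<n. X i)" for n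
  have S_diff: "\<bar>S n\<bar> \<le> \<bar>S m\<bar> + real (n - m)" if "m \<le> n" for m n
  proof -
    have "S n = S m + (\<Sum>i=m..<n. X i)"
      using sum.atLeastLessThan_concat[of 0 m n X] that by (simp add: S_def atLeast0LessThan)
    moreover have "\<bar>\<Sum>i=m..<n. X i\<bar> \<le> (\<Sum>i=m..<n. 1)"
      by (rule order_trans[OF sum_abs sum_mono]) (rule bd)
    ultimately show ?thesis by simp
  qed
  define B where "B k = \<bar>S (k\<^sup>2) / (real k)\<^sup>2\<bar> + 2 / real k" for k
  have "B \<longlonglongrightarrow> \<bar>0\<bar> + 0"
    unfolding B_def S_def by (intro tendsto_intros sub lim_const_over_n)
  then have "B \<longlonglongrightarrow> 0" by simp
  moreover have "filterlim floor_sqrt at_top sequentially"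
    unfolding filterlim_at_top
  proof
    fix Z :: nat
    show "\<forall>\<^sub>F n in sequentially. Z \<le> floor_sqrt n"
      using eventually_ge_at_top[of "Z\<^sup>2"]
      by eventually_elim (simp add: le_floor_sqrt_iff)
  qed
  ultimately have lim: "(\<lambda>n. B (floor_sqrt n)) \<longlonglongrightarrow> 0"
    by (rule filterlim_compose)
  have "\<forall>\<^sub>F n in sequentially. norm (S n / real n) \<le> B (floor_sqrt n)"
    using eventually_ge_at_top[of 1]
  proof eventually_elim
    case (elim n)
    define k where "k = floor_sqrt n"
    have k: "k\<^sup>2 \<le> n" "n < (Suc k)\<^sup>2"
      by (simp_all add: k_def Suc_floor_sqrt_power2_gt)
    have k1: "k \<ge> 1" using elim by (simp add: k_def Suc_le_eq)
    have "n - k\<^sup>2 \<le> 2 * k" using k by (simp add: power2_eq_square)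
    then have "\<bar>S n\<bar> \<le> \<bar>S (k\<^sup>2)\<bar> + 2 * real k" using S_diff[OF k(1)] by linarith
    then have "\<bar>S n\<bar> / real n \<le> (\<bar>S (k\<^sup>2)\<bar> + 2 * real k) / real n"
      by (rule divide_right_mono) simp
    also have "\<dots> \<le> (\<bar>S (k\<^sup>2)\<bar> + 2 * real k) / (real k)\<^sup>2"
    proof (rule divide_left_mono)
      show "(real k)\<^sup>2 \<le> real n" using k(1) by (metis of_nat_le_iff of_nat_power)
      show "0 < real n * (real k)\<^sup>2" using k1 elim by simp
    qed simp
    also have "\<dots> = B k" using k1 by (simp add: B_def add_divide_distrib power2_eq_square)
    finally show ?case by (simp add: k_def)
  qed
  then have "(\<lambda>n. S n / real n) \<longlonglongrightarrow> 0" using lim by (rule Lim_null_comparison)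
  then show ?thesis by (simp add: S_def)
qed

text \<open>By monotone convergence the series of the \<open>Y k\<close> has finite expectation, so
  almost surely it converges and its terms vanish.\<close>

lemma (in prob_space) AE_tendsto_zero_of_summable_expectation:
  fixes Y :: "nat \<Rightarrow> 'a \<Rightarrow> real"
  assumes [measurable]: "\<And>k. random_variable borel (Y k)"
    and nn: "\<And>k \<omega>. Y k \<omega> \<ge> 0" and int: "\<And>k. integrable M (Y k)"
    and le: "\<And>k. expectation (Y k) \<le> c k" and sm: "summable c"
  shows "AE \<omega> in M. (\<lambda>k. Y k \<omega>) \<longlonglongrightarrow> 0"
proof -
  have c0: "c k \<ge> 0" for k by (rule order_trans[OF Bochner_Integration.integral_nonneg le]) (rule nn)
  have "(\<integral>\<^sup>+\<omega>. (\<Sum>k. ennreal (Y k \<omega>)) \<partial>M) = (\<Sum>k. \<integral>\<^sup>+\<omega>. ennreal (Y k \<omega>) \<partial>M)"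
    by (rule nn_integral_suminf) simp
  also have "\<dots> = (\<Sum>k. ennreal (expectation (Y k)))"
    by (intro suminf_cong nn_integral_eq_integral int) (simp add: nn)
  also have "\<dots> \<le> (\<Sum>k. ennreal (c k))"
    by (intro suminf_le ennreal_leI le) auto
  also have "\<dots> = ennreal (\<Sum>k. c k)" by (rule suminf_ennreal2[OF c0 sm])
  finally have "(\<integral>\<^sup>+\<omega>. (\<Sum>k. ennreal (Y k \<omega>)) \<partial>M) \<noteq> \<infinity>"
    by (auto simp: top_unique)
  then have "AE \<omega> in M. (\<Sum>k. ennreal (Y k \<omega>)) \<noteq> \<infinity>"
    by (intro nn_integral_PInf_AE) auto
  then show ?thesis
  proof eventually_elim
    case (elim \<omega>)
    then have "summable (\<lambda>k. Y k \<omega>)" by (intro summable_suminf_not_top nn) simp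
    then show ?case by (rule summable_LIMSEQ_zero)
  qed
qed

text \<open>Orthogonality takes the place of independence, which adaptive choices destroy. The
  second moment of a sum of \<open>n\<close> terms is at most \<open>n\<close>, so along squares the
  means have second moments at most \<open>1 / k^2\<close>, which are summable.\<close>

lemma (in prob_space) strong_law_bounded_orthogonal:
  fixes X :: "nat \<Rightarrow> 'a \<Rightarrow> real"
  assumes meas [measurable]: "\<And>n. random_variable borel (X n)"
    and bd: "\<And>n \<omega>. \<bar>X n \<omega>\<bar> \<le> 1"
    and orth: "\<And>m n. m < n \<Longrightarrow> expectation (\<lambda>\<omega>. X m \<omega> * X n \<omega>) = 0"
  shows "AE \<omega> in M. (\<lambda>n. (\<Sum>i<n. X i \<omega>) / real n) \<longlonglongrightarrow> 0"
proof -
  have int: "integrable M (\<lambda>\<omega>. X m \<omega> * X n \<omega>)" for m n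
    by (rule integrable_const_bound[of _ 1]) (auto simp: abs_mult intro!: mult_le_one bd)
  have sq: "(\<Sum>i<n. X i \<omega>)\<^sup>2 = (\<Sum>i<n. \<Sum>j<n. X i \<omega> * X j \<omega>)" for n \<omega>
    by (simp add: power2_eq_square sum_product)
  have intS: "integrable M (\<lambda>\<omega>. (\<Sum>i<n. X i \<omega>)\<^sup>2)" for n
    unfolding sq by (intro Bochner_Integration.integrable_sum int)
  have ES: "expectation (\<lambda>\<omega>. (\<Sum>i<n. X i \<omega>)\<^sup>2) \<le> real n" for n
  proof -
    have o: "expectation (\<lambda>\<omega>. X i \<omega> * X j \<omega>) = 0" if "i \<noteq> j" for i j
      using that orth[of i j] orth[of j i] by (cases "i < j") (simp_all add: mult.commute)
    have d: "expectation (\<lambda>\<omega>. X i \<omega> * X i \<omega>) \<le> 1" for i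
      by (rule integral_le_const[OF int]) (use bd in \<open>auto simp: power2_eq_square[symmetric] abs_square_le_1\<close>)
    have "expectation (\<lambda>\<omega>. (\<Sum>i<n. X i \<omega>)\<^sup>2) = (\<Sum>i<n. \<Sum>j<n. expectation (\<lambda>\<omega>. X i \<omega> * X j \<omega>))"
      unfolding sq by (subst Bochner_Integration.integral_sum, intro Bochner_Integration.integrable_sum int,
          subst Bochner_Integration.integral_sum, rule int, rule refl)
    also have "\<dots> = (\<Sum>i<n. \<Sum>j<n. if j = i then expectation (\<lambda>\<omega>. X i \<omega> * X i \<omega>) else 0)"
      using o by (intro sum.cong refl) auto
    also have "\<dots> = (\<Sum>i<n. expectation (\<lambda>\<omega>. X i \<omega> * X i \<omega>))" by simp
    also have "\<dots> \<le> (\<Sum>i<n. 1)" by (intro sum_mono d)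
    finally show ?thesis by simp
  qed
  define Y where "Y k \<omega> = ((\<Sum>i<k\<^sup>2. X i \<omega>) / (real k)\<^sup>2)\<^sup>2" for k \<omega>
  have "AE \<omega> in M. (\<lambda>k. Y k \<omega>) \<longlonglongrightarrow> 0"
  proof (rule AE_tendsto_zero_of_summable_expectation)
    show "random_variable borel (Y k)" for k unfolding Y_def by measurable
    show "Y k \<omega> \<ge> 0" for k \<omega> by (simp add: Y_def)
    show "integrable M (Y k)" for k unfolding Y_def power_divide by (intro integrable_divide_zero intS)
    show "expectation (Y k) \<le> 1 / real k ^ 2" for k
    proof -
      have "expectation (Y k) = expectation (\<lambda>\<omega>. (\<Sum>i<k\<^sup>2. X i \<omega>)\<^sup>2) / ((real k)\<^sup>2)\<^sup>2"
        unfolding Y_def power_divide by simp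
      also have "\<dots> \<le> real (k\<^sup>2) / ((real k)\<^sup>2)\<^sup>2" by (intro divide_right_mono ES) simp
      also have "\<dots> = 1 / real k ^ 2" by (simp add: power2_eq_square)
      finally show ?thesis .
    qed
    show "summable (\<lambda>k. 1 / real k ^ 2)"
      using inverse_power_summable[of 2, where 'a=real] by (simp add: inverse_eq_divide)
  qed
  then show ?thesis
  proof eventually_elim
    case (elim \<omega>)
    have "(\<lambda>k. sqrt (Y k \<omega>)) \<longlonglongrightarrow> sqrt 0" by (intro tendsto_intros elim)
    then have "(\<lambda>k. \<bar>(\<Sum>i<k\<^sup>2. X i \<omega>) / (real k)\<^sup>2\<bar>) \<longlonglongrightarrow> 0" by (simp add: Y_def)
    then have "(\<lambda>k. (\<Sum>i<k\<^sup>2. X i \<omega>) / (real k)\<^sup>2) \<longlonglongrightarrow> 0" by (rule tendsto_rabs_zero_cancel)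
    then show ?case by (intro mean_tendsto_zero_of_squares bd)
  qed
qed

section \<open>Logistic responses\<close>

lemma one_plus_exp_nonzero: "1 + exp x \<noteq> (0::real)"
  by (metis add_pos_pos exp_gt_zero less_irrefl zero_less_one)

lemma mu_gt_0: "0 < mu x"
  by (simp add: mu_def add_pos_pos)

lemma mu_alt: "mu x = exp x / (1 + exp x)"
  by (simp add: mu_def exp_minus field_simps add_pos_pos)

lemma one_minus_mu: "1 - mu x = 1 / (1 + exp x)"
  unfolding mu_alt using one_plus_exp_nonzero[of x] by (simp add: field_simps)

lemma mu_lt_1: "mu x < 1"
proof -
  have "1 - mu x > 0" unfolding one_minus_mu by (simp add: add_pos_pos)
  then show ?thesis by simp
qed

lemma mu_mono: "x \<le> y \<Longrightarrow> mu x \<le> mu y"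
  by (simp add: mu_def frac_le add_pos_pos)

lemma ln_mu: "ln (mu x) = x - ln (1 + exp x)"
  by (simp add: mu_alt ln_div add_pos_pos one_plus_exp_nonzero)

lemma ln_one_minus_mu: "ln (1 - mu x) = - ln (1 + exp x)"
  by (simp add: one_minus_mu ln_div add_pos_pos)

lemma mudot_pos: "0 < mudot x"
  using mu_gt_0 mu_lt_1 by (simp add: mudot_def)

lemma mudot_le: "4 * mudot x \<le> 1"
proof -
  have "1 - 4 * mudot x = (1 - 2 * mu x)\<^sup>2" by (simp add: mudot_def power2_eq_square algebra_simps)
  then show ?thesis by (metis diff_ge_0_iff_ge zero_le_power2)
qed

text \<open>The two factors of \<open>mudot\<close> are bounded separately at opposite ends of the
  interval; the result is a positive uniform curvature bound.\<close>

lemma mudot_lower: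
  assumes "\<bar>x\<bar> \<le> X"
  shows "mu (- X) * (1 - mu X) \<le> mudot x"
  unfolding mudot_def using assms mu_gt_0 mu_lt_1
  by (intro mult_mono) (auto simp: less_imp_le intro!: mu_mono)

lemma DERIV_softplus: "((\<lambda>x. ln (1 + exp x)) has_real_derivative mu x) (at x)"
  by (auto intro!: derivative_eq_intros simp: mu_alt add_pos_pos)

lemma DERIV_mu: "(mu has_real_derivative mudot x) (at x)"
proof -
  have "((\<lambda>w. 1 / (1 + exp (- w))) has_real_derivative mudot x) (at x)"
    using one_plus_exp_nonzero[of "- x"]
    by (auto intro!: derivative_eq_intros simp: mudot_def mu_def power2_eq_square field_simps)
  then show ?thesis by (simp add: mu_def[abs_def])
qed

lemma isCont_mudot: "isCont mudot x"
  unfolding mudot_def[abs_def] using DERIV_isCont[OF DERIV_mu] by (intro continuous_intros) auto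

text \<open>Subtracting \<open>c / 2 * x^2\<close> leaves a convex function on the interval, and the
  claim is its tangent inequality.\<close>

lemma softplus_strongly_convex:
  assumes x: "\<bar>x\<bar> \<le> X" and y: "\<bar>y\<bar> \<le> X"
  shows "mu x * (y - x) + mu (- X) * (1 - mu X) / 2 * (y - x)\<^sup>2 \<le> ln (1 + exp y) - ln (1 + exp x)"
proof -
  define c where "c = mu (- X) * (1 - mu X)"
  have "(mu x - c * x) * (y - x) \<le> (ln (1 + exp y) - c / 2 * y\<^sup>2) - (ln (1 + exp x) - c / 2 * x\<^sup>2)"
  proof (rule f''_imp_f'[of "{-X..X}" "\<lambda>x. ln (1 + exp x) - c / 2 * x\<^sup>2" "\<lambda>x. mu x - c * x" "\<lambda>x. mudot x - c"])
    fix s assume s: "s \<in> {-X..X}"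
    show "((\<lambda>x. ln (1 + exp x) - c / 2 * x\<^sup>2) has_real_derivative mu s - c * s) (at s)"
      by (rule derivative_eq_intros DERIV_softplus refl)+ simp
    show "((\<lambda>x. mu x - c * x) has_real_derivative mudot s - c) (at s)"
      by (rule derivative_eq_intros DERIV_mu refl)+ simp
    show "0 \<le> mudot s - c" using mudot_lower[of s X] s by (auto simp: c_def)
  qed (use x y in auto)
  then show ?thesis unfolding c_def[symmetric] by (simp add: power2_eq_square algebra_simps)
qed

section \<open>Pathwise convergence for logistic responses\<close>

text \<open>Coefficient of \<open>outer (fst p)\<close> in the Fisher information of one response at
  \<open>p\<close>.\<close>

abbreviation (input) logistic_weight :: "real^'d \<Rightarrow> (real^'d) \<times> real \<Rightarrow> real" where
  "logistic_weight \<theta> p \<equiv> mudot (snd p * (\<theta> \<bullet> fst p)) * (snd p)\<^sup>2"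

lemma info_matrix_eq: "info_matrix Fs \<xi> \<theta> = design_mat Fs fst (logistic_weight \<theta>) \<xi>"
  by (simp add: info_matrix_def design_mat_def mult.assoc)

lemma Hmat_eq: "Hmat z b t \<theta> = wmat fst (logistic_weight \<theta>) (\<lambda>s. (z s, b s)) t"
  by (simp add: Hmat_def wmat_def)

lemma loglik_eq:
  "loglik z b y t \<theta> = (1 / real t) *
    (\<Sum>s\<in>{1..t}. y s * (b s * (\<theta> \<bullet> z s)) - ln (1 + exp (b s * (\<theta> \<bullet> z s))))"
  unfolding loglik_def ln_mu ln_one_minus_mu by (simp add: algebra_simps)

text \<open>The deterministic part, for one fixed path: randomness is represented by
  \<open>noise\<close> alone, and the maximum likelihood property by a comparison with
  \<open>\<theta>star\<close>.\<close>

lemma adaptive_design_converges: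
  fixes Fs :: "((real^'d) \<times> real) set" and z :: "nat \<Rightarrow> real^'d" and th :: "nat \<Rightarrow> real^'d"
  assumes fin: "finite Fs"
    and b_pos: "\<And>p. p \<in> Fs \<Longrightarrow> snd p > 0"
    and X_bound: "\<And>p \<theta>. p \<in> Fs \<Longrightarrow> \<theta> \<in> \<Theta> \<Longrightarrow> \<bar>snd p * (\<theta> \<bullet> fst p)\<bar> \<le> X"
    and star: "\<theta>star \<in> \<Theta>"
    and feas: "\<And>s. s \<ge> 1 \<Longrightarrow> (z s, b s) \<in> Fs"
    and t0: "t0 \<ge> 1"
    and init: "posdef (info_matrix Fs (emp_design (\<lambda>s. (z s, b s)) t0) \<theta>star)"
    and th_in: "\<And>t. t \<ge> t0 \<Longrightarrow> th t \<in> \<Theta>"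
    and select: "\<And>t p. t \<ge> t0 \<Longrightarrow> p \<in> Fs \<Longrightarrow>
        det (Hmat z b t (th t) + logistic_weight (th t) p *\<^sub>R outer (fst p))
        \<le> det (Hmat z b t (th t) + logistic_weight (th t) (z (Suc t), b (Suc t)) *\<^sub>R outer (z (Suc t)))"
    and mle: "\<And>t. t > t0 \<Longrightarrow> loglik z b y t \<theta>star \<le> loglik z b y t (th t)"
    and noise: "\<And>p. p \<in> Fs \<Longrightarrow> (\<lambda>T. (\<Sum>s\<in>{1..T}. if (z s, b s) = p
        then y s - mu (snd p * (\<theta>star \<bullet> fst p)) else 0) / real T) \<longlonglongrightarrow> 0"
    and design: "is_design Fs \<xi>"
    and opt: "\<And>\<eta>. is_design Fs \<eta> \<Longrightarrow> det (info_matrix Fs \<eta> \<theta>star) \<le> det (info_matrix Fs \<xi> \<theta>star)"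
    and pd: "posdef (info_matrix Fs \<xi> \<theta>star)"
  shows "(\<lambda>T. info_matrix Fs (emp_design (\<lambda>s. (z s, b s)) T) (th T)) \<longlonglongrightarrow> info_matrix Fs \<xi> \<theta>star"
proof -
  define q where "q s = (z s, b s)" for s
  define c where "c = mu (- X) * (1 - mu X)"
  have c: "c > 0" using mu_gt_0 mu_lt_1 by (simp add: c_def)
  let ?w = "logistic_weight"
  have c_low: "c \<le> mudot (snd p * (\<theta> \<bullet> fst p))" if "p \<in> Fs" "\<theta> \<in> \<Theta>" for p \<theta>
    unfolding c_def by (intro mudot_lower X_bound that)
  \<comment> \<open>\<open>mudot\<close> lies between \<open>c\<close> and \<open>1/4\<close> at all
    relevant arguments, so weights at any two parameters differ by a bounded factor. This supplies
    \<open>\<kappa> = 4 * c\<close> in both directions.\<close>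
  have comparable: "4 * c * ?w \<theta> p \<le> ?w \<theta>' p" if "p \<in> Fs" "\<theta>' \<in> \<Theta>" for p \<theta> \<theta>'
  proof -
    have "c * (4 * mudot (snd p * (\<theta> \<bullet> fst p))) \<le> c * 1" using c by (intro mult_left_mono mudot_le) auto
    also have "\<dots> \<le> mudot (snd p * (\<theta>' \<bullet> fst p))" using c_low[OF that] by simp
    finally have "c * (4 * mudot (snd p * (\<theta> \<bullet> fst p))) * (snd p)\<^sup>2
        \<le> mudot (snd p * (\<theta>' \<bullet> fst p)) * (snd p)\<^sup>2" by (rule mult_right_mono) simp
    then show ?thesis by (simp add: mult_ac)
  qed
  have wmat_emp: "info_matrix Fs (emp_design q t) \<theta> = (1 / real t) *\<^sub>R wmat fst (?w \<theta>) q t" for t \<theta>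
    using wmat_eq_design_mat[OF fin, of q t fst "?w \<theta>"] feas
    by (simp add: info_matrix_eq emp_design_def[abs_def] q_def)
  interpret greedy_design Fs fst "?w \<theta>star" "\<lambda>t. ?w (th t)" q t0 "4 * c"
  proof
    show "posdef (wmat fst (?w \<theta>star) q t0)"
      by (rule posdef_mono[OF init wmat_symmetric, of "real t0"])
        (use t0 in \<open>auto simp: q_def[symmetric] wmat_emp matrix_scaleR_mult\<close>)
    show "det (wmat fst (?w (th t)) q t + ?w (th t) p *\<^sub>R outer (fst p))
      \<le> det (wmat fst (?w (th t)) q t + ?w (th t) (q (Suc t)) *\<^sub>R outer (fst (q (Suc t))))"
      if "t \<ge> t0" "p \<in> Fs" for t p
      using select[OF that] by (simp add: Hmat_eq q_def[abs_def])
    show "q s \<in> Fs" if "s \<ge> 1" for s using feas[OF that] by (simp add: q_def)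
    show "?w \<theta>star p > 0" if "p \<in> Fs" for p using b_pos[OF that] mudot_pos by simp
  qed (use fin c comparable star th_in in auto)
  obtain C T1 where C: "C > 0" "T1 \<ge> t0" "T1 \<ge> 1"
    and sb: "\<And>T p. T \<ge> T1 \<Longrightarrow> p \<in> Fs \<Longrightarrow> real T * score T p \<le> C"
    using score_bound by blast
  define x where "x \<theta> p = snd p * (\<theta> \<bullet> fst p)" for \<theta> and p :: "(real^'d) \<times> real"
  define E where "E T p = (\<Sum>s\<in>{1..T}. if q s = p then y s - mu (x \<theta>star p) else 0) / real T" for T p
  \<comment> \<open>Predictions differ by at most \<open>2 * X\<close>, and the quadratic term
    carries \<open>c / 2\<close>; the quotient is the factor \<open>4 * X / c\<close>.\<close>
  define V where "V T = 4 * X / c * (\<Sum>p\<in>Fs. \<bar>E T p\<bar>)" for T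
  have "V \<longlonglongrightarrow> 4 * X / c * (\<Sum>p\<in>Fs. \<bar>0\<bar>)"
    unfolding V_def E_def x_def q_def by (intro tendsto_intros noise)
  then have V_lim: "V \<longlonglongrightarrow> 0" by simp
  \<comment> \<open>The likelihood at \<open>th T\<close> is at least that at
    \<open>\<theta>star\<close>; by strong convexity the squared prediction errors are then bounded
    by a noise term. Grouping the latter by design point leaves finitely many averages
    \<open>E T p\<close>, whatever the estimate is.\<close>
  have est: "(\<Sum>s\<in>{1..T}. (x (th T) (q s) - x \<theta>star (q s))\<^sup>2) \<le> real T * V T" if T: "T > t0" for T
  proof -
    define D where "D p = x (th T) p - x \<theta>star p" for p
    have X1: "\<bar>x (th T) p\<bar> \<le> X" "\<bar>x \<theta>star p\<bar> \<le> X" if "p \<in> Fs" for p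
      unfolding x_def using X_bound[OF that] th_in[of T] star T by auto
    have qF: "q s \<in> Fs" if "s \<in> {1..T}" for s using that q_in by simp
    have "loglik z b y T \<theta>star \<le> loglik z b y T (th T)" by (rule mle[OF T])
    then have "(\<Sum>s\<in>{1..T}. y s * x \<theta>star (q s) - ln (1 + exp (x \<theta>star (q s))))
        \<le> (\<Sum>s\<in>{1..T}. y s * x (th T) (q s) - ln (1 + exp (x (th T) (q s))))"
      using T by (simp add: loglik_eq x_def q_def divide_le_cancel)
    then have "0 \<le> (\<Sum>s\<in>{1..T}. y s * D (q s) - (ln (1 + exp (x (th T) (q s))) - ln (1 + exp (x \<theta>star (q s)))))"
      by (simp add: D_def sum_subtractf right_diff_distrib)
    also have "\<dots> \<le> (\<Sum>s\<in>{1..T}. y s * D (q s) - (mu (x \<theta>star (q s)) * D (q s) + c / 2 * (D (q s))\<^sup>2))"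
      unfolding D_def c_def
      by (intro sum_mono diff_left_mono softplus_strongly_convex X1 qF)
    also have "\<dots> = (\<Sum>s\<in>{1..T}. (y s - mu (x \<theta>star (q s))) * D (q s)) - c / 2 * (\<Sum>s\<in>{1..T}. (D (q s))\<^sup>2)"
      by (simp add: sum_subtractf sum_distrib_left left_diff_distrib sum.distrib)
    finally have 1: "c / 2 * (\<Sum>s\<in>{1..T}. (D (q s))\<^sup>2) \<le> (\<Sum>s\<in>{1..T}. (y s - mu (x \<theta>star (q s))) * D (q s))"
      by simp
    have "(\<Sum>s\<in>{1..T}. (y s - mu (x \<theta>star (q s))) * D (q s))
        = (\<Sum>p\<in>Fs. \<Sum>s\<in>{s\<in>{1..T}. q s = p}. (y s - mu (x \<theta>star (q s))) * D (q s))"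
      by (rule sum.group[symmetric]) (use fin qF in auto)
    also have "\<dots> = (\<Sum>p\<in>Fs. D p * (real T * E T p))"
    proof (intro sum.cong refl)
      fix p
      have "(\<Sum>s\<in>{s\<in>{1..T}. q s = p}. (y s - mu (x \<theta>star (q s))) * D (q s))
          = (\<Sum>s\<in>{s\<in>{1..T}. q s = p}. D p * (y s - mu (x \<theta>star p)))"
        by (intro sum.cong refl) auto
      also have "\<dots> = D p * (\<Sum>s\<in>{1..T}. if q s = p then y s - mu (x \<theta>star p) else 0)"
        by (simp only: sum_distrib_left[symmetric] sum.inter_filter[OF finite_atLeastAtMost])
      also have "\<dots> = D p * (real T * E T p)" using T by (simp add: E_def)
      finally show "(\<Sum>s\<in>{s\<in>{1..T}. q s = p}. (y s - mu (x \<theta>star (q s))) * D (q s)) = D p * (real T * E T p)" .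
    qed
    also have "\<dots> \<le> (\<Sum>p\<in>Fs. 2 * X * (real T * \<bar>E T p\<bar>))"
    proof (rule sum_mono)
      fix p assume "p \<in> Fs"
      then have D: "\<bar>D p\<bar> \<le> 2 * X" using X1[of p] by (simp add: D_def)
      have "D p * (real T * E T p) \<le> \<bar>D p\<bar> * (real T * \<bar>E T p\<bar>)"
        by (metis abs_ge_self abs_mult abs_of_nat)
      also have "\<dots> \<le> 2 * X * (real T * \<bar>E T p\<bar>)" by (intro mult_right_mono D) simp
      finally show "D p * (real T * E T p) \<le> 2 * X * (real T * \<bar>E T p\<bar>)" .
    qed
    also have "\<dots> = c / 2 * (real T * V T)" using c by (simp add: V_def sum_distrib_left[symmetric])
    finally have "c / 2 * (\<Sum>s\<in>{1..T}. (D (q s))\<^sup>2) \<le> c / 2 * (real T * V T)" using 1 by simp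
    then show ?thesis using c by (simp add: D_def)
  qed
  \<comment> \<open>Cauchy-Schwarz bounds the squared error at \<open>p\<close> by the inverse form,
    of order \<open>1 / T\<close>, times the accumulated error, at most \<open>T * V T\<close>. The
    factors \<open>T\<close> cancel.\<close>
  have consistent: "(\<lambda>T. th T \<bullet> fst p) \<longlonglongrightarrow> \<theta>star \<bullet> fst p" if p: "p \<in> Fs" for p
  proof -
    let ?ws = "?w \<theta>star p"
    have ws: "?ws > 0" using ws_pos[OF p] .
    have "\<forall>\<^sub>F T in sequentially. norm ((th T \<bullet> fst p - \<theta>star \<bullet> fst p)\<^sup>2) \<le> C / ?ws * V T"
      using eventually_gt_at_top[of T1]
    proof eventually_elim
      case (elim T)
      then have T: "T > t0" "T \<ge> T1" "real T > 0" using C by auto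
      let ?H = "wmat fst (?w \<theta>star) q T" and ?d = "th T - \<theta>star"
      have "?d \<bullet> (?H *v ?d) = (\<Sum>s\<in>{1..T}. mudot (x \<theta>star (q s)) * (x (th T) (q s) - x \<theta>star (q s))\<^sup>2)"
        unfolding wmat_form
        by (intro sum.cong refl)
          (simp add: x_def inner_diff_left inner_diff_right inner_commute power2_eq_square algebra_simps)
      also have "\<dots> \<le> (\<Sum>s\<in>{1..T}. 1 * (x (th T) (q s) - x \<theta>star (q s))\<^sup>2)"
      proof (intro sum_mono mult_right_mono)
        show "mudot (x \<theta>star (q s)) \<le> 1" for s
          using mudot_le[of "x \<theta>star (q s)"] mudot_pos[of "x \<theta>star (q s)"] by linarith
      qed simp
      also have "\<dots> \<le> real T * V T" using est[OF T(1)] by simp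
      finally have dH: "?d \<bullet> (?H *v ?d) \<le> real T * V T" .
      have pdH: "posdef ?H" using posdef_wmat T by simp
      have inv0: "inv_form ?H (fst p) \<ge> 0" by (rule inv_form_nonneg[OF pdH])
      have "(fst p \<bullet> ?d)\<^sup>2 \<le> inv_form ?H (fst p) * (?d \<bullet> (?H *v ?d))"
        by (rule inv_form_cauchy_schwarz[OF pdH])
      also have "\<dots> \<le> inv_form ?H (fst p) * (real T * V T)" by (intro mult_left_mono dH inv0)
      finally have "?ws * (fst p \<bullet> ?d)\<^sup>2 \<le> ?ws * (inv_form ?H (fst p) * (real T * V T))"
        using ws by (intro mult_left_mono) auto
      also have "\<dots> = (real T * score T p) * V T" by (simp add: mult_ac)
      also have "\<dots> \<le> C * V T"
      proof (rule mult_right_mono[OF sb[OF T(2) p]])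
        have "0 \<le> real T * V T"
          using est[OF T(1)] by (rule order_trans[rotated]) (simp add: sum_nonneg)
        then show "0 \<le> V T" using T(3) by (simp add: zero_le_mult_iff)
      qed
      finally have "(fst p \<bullet> ?d)\<^sup>2 \<le> C / ?ws * V T" using ws by (simp add: field_simps)
      then show ?case by (simp add: inner_diff_right inner_commute)
    qed
    moreover have "(\<lambda>T. C / ?ws * V T) \<longlonglongrightarrow> 0" by (rule tendsto_mult_right_zero[OF V_lim])
    ultimately have "(\<lambda>T. (th T \<bullet> fst p - \<theta>star \<bullet> fst p)\<^sup>2) \<longlonglongrightarrow> 0" by (rule Lim_null_comparison)
    then have "(\<lambda>T. th T \<bullet> fst p - \<theta>star \<bullet> fst p) \<longlonglongrightarrow> 0" by simp
    then show ?thesis by (simp add: LIM_zero_iff)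
  qed
  have w_lim: "(\<lambda>T. ?w (th T) p) \<longlonglongrightarrow> ?w \<theta>star p" if p: "p \<in> Fs" for p
    by (intro tendsto_intros isCont_tendsto_compose[OF isCont_mudot] consistent p)
  have "(\<lambda>t. (1 / real t) *\<^sub>R wmat fst (?w \<theta>star) q t) \<longlonglongrightarrow> design_mat Fs fst (?w \<theta>star) \<xi>"
  proof (rule wmat_tendsto_optimal[OF w_lim])
    show "\<xi> p \<ge> 0" for p using design unfolding is_design_def by blast
    show "sum \<xi> Fs = 1" using design by (simp add: is_design_def)
    show "posdef (design_mat Fs fst (?w \<theta>star) \<xi>)" using pd by (simp add: info_matrix_eq)
    fix \<eta> :: "(real^'d) \<times> real \<Rightarrow> real"
    assume \<eta>: "\<And>p. p \<in> Fs \<Longrightarrow> \<eta> p \<ge> 0" "sum \<eta> Fs = 1"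
    \<comment> \<open>\<open>is_design\<close> demands zero mass outside \<open>Fs\<close>, so the
      competitor is extended by zero.\<close>
    let ?e = "\<lambda>p. if p \<in> Fs then \<eta> p else 0"
    have "sum ?e Fs = sum \<eta> Fs" by (intro sum.cong) auto
    then have "is_design Fs ?e" using \<eta> by (simp add: is_design_def)
    from opt[OF this] have "det (design_mat Fs fst (?w \<theta>star) ?e) \<le> det (design_mat Fs fst (?w \<theta>star) \<xi>)"
      by (simp add: info_matrix_eq)
    moreover have "design_mat Fs fst (?w \<theta>star) ?e = design_mat Fs fst (?w \<theta>star) \<eta>"
      unfolding design_mat_def by (intro sum.cong) auto
    ultimately show "det (design_mat Fs fst (?w \<theta>star) \<eta>) \<le> det (design_mat Fs fst (?w \<theta>star) \<xi>)" by simp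
  qed
  then have lim1: "(\<lambda>t. info_matrix Fs (emp_design q t) \<theta>star) \<longlonglongrightarrow> info_matrix Fs \<xi> \<theta>star"
    unfolding wmat_emp by (simp add: info_matrix_eq)
  \<comment> \<open>Passage from \<open>\<theta>star\<close> to the estimate inside the weights:
    empirical masses are at most \<open>1\<close> and the weights converge.\<close>
  have "(\<lambda>t. \<Sum>p\<in>Fs. (emp_design q t p * (?w (th t) p - ?w \<theta>star p)) *\<^sub>R outer (fst p)) \<longlonglongrightarrow> (\<Sum>p\<in>Fs. 0)"
  proof (rule tendsto_sum)
    fix p assume p: "p \<in> Fs"
    have bound: "norm (emp_design q t p * (?w (th t) p - ?w \<theta>star p)) \<le> \<bar>?w (th t) p - ?w \<theta>star p\<bar>" for t
    proof -
      have "card {s \<in> {1..t}. q s = p} \<le> card {1..t}" by (rule card_mono) auto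
      then have "\<bar>emp_design q t p\<bar> \<le> 1" by (cases "t = 0") (simp_all add: emp_design_def divide_le_eq_1)
      then have "\<bar>emp_design q t p\<bar> * \<bar>?w (th t) p - ?w \<theta>star p\<bar> \<le> 1 * \<bar>?w (th t) p - ?w \<theta>star p\<bar>"
        by (rule mult_right_mono) simp
      then show ?thesis by (simp add: abs_mult)
    qed
    have "(\<lambda>t. \<bar>?w (th t) p - ?w \<theta>star p\<bar>) \<longlonglongrightarrow> 0"
      by (rule tendsto_rabs_zero) (rule LIM_zero[OF w_lim[OF p]])
    then have "(\<lambda>t. emp_design q t p * (?w (th t) p - ?w \<theta>star p)) \<longlonglongrightarrow> 0"
      by (rule Lim_null_comparison[OF always_eventually[OF allI[OF bound]]])
    then have "(\<lambda>t. (emp_design q t p * (?w (th t) p - ?w \<theta>star p)) *\<^sub>R outer (fst p)) \<longlonglongrightarrow> 0 *\<^sub>R outer (fst p)"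
      by (intro tendsto_intros)
    then show "(\<lambda>t. (emp_design q t p * (?w (th t) p - ?w \<theta>star p)) *\<^sub>R outer (fst p)) \<longlonglongrightarrow> 0" by simp
  qed
  moreover have "info_matrix Fs (emp_design q t) (th t) = info_matrix Fs (emp_design q t) \<theta>star
      + (\<Sum>p\<in>Fs. (emp_design q t p * (?w (th t) p - ?w \<theta>star p)) *\<^sub>R outer (fst p))" for t
    unfolding info_matrix_eq design_mat_def sum.distrib[symmetric] scaleR_left_distrib[symmetric]
    by (simp add: algebra_simps)
  ultimately have "(\<lambda>t. info_matrix Fs (emp_design q t) (th t)) \<longlonglongrightarrow> info_matrix Fs \<xi> \<theta>star + (\<Sum>p\<in>Fs. 0)"
    using tendsto_add[OF lim1] by presburger
  then show ?thesis by (simp add: q_def[abs_def])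
qed

section \<open>Noise averages and the almost sure limit\<close>

text \<open>For fixed \<open>p\<close>, the centred responses in the rounds that choose
  \<open>p\<close> are martingale differences: the choice is known to \<open>G n\<close>, and given
  it the response has mean \<open>r\<close>. They are therefore orthogonal.\<close>

lemma noise_average_tendsto_zero:
  fixes P :: "'o measure" and G :: "nat \<Rightarrow> 'o measure" and zs :: "nat \<Rightarrow> 'o \<Rightarrow> real^'d"
    and p :: "(real^'d) \<times> real"
  assumes prob: "prob_space P"
    and subalg: "\<And>t. sigma_finite_subalgebra P (G t)"
    and G_mono: "\<And>s t. s \<le> t \<Longrightarrow> sets (G s) \<subseteq> sets (G t)"
    and y_binary: "\<And>t \<omega>. ys t \<omega> \<in> {0, 1}"
    and y_meas: "\<And>s t. s < t \<Longrightarrow> ys s \<in> borel_measurable (G t)"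
    and z_meas: "\<And>t. zs t \<in> borel_measurable (G t)"
    and b_meas: "\<And>t. bs t \<in> borel_measurable (G t)"
    and y_cond: "\<And>t. t > t0 \<Longrightarrow>
      AE \<omega> in P. real_cond_exp P (G t) (ys t) \<omega> = mu (bs t \<omega> * (\<theta>star \<bullet> zs t \<omega>))"
  shows "AE \<omega> in P. (\<lambda>T. (\<Sum>s\<in>{1..T}. if (zs s \<omega>, bs s \<omega>) = p
      then ys s \<omega> - mu (snd p * (\<theta>star \<bullet> fst p)) else 0) / real T) \<longlonglongrightarrow> 0"
proof -
  interpret prob_space P by (rule prob)
  define r where "r = mu (snd p * (\<theta>star \<bullet> fst p))"
  have r: "0 < r" "r < 1" by (simp_all add: r_def mu_gt_0 mu_lt_1)
  define I where "I n \<omega> = (if zs n \<omega> = fst p \<and> bs n \<omega> = snd p then 1 else 0 :: real)" for n \<omega>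
  \<comment> \<open>The terms up to \<open>t0\<close> are set to zero, since \<open>y_cond\<close>
    concerns only later responses.\<close>
  define X where "X n \<omega> = (if n \<le> t0 then 0 else I n \<omega> * (ys n \<omega> - r))" for n \<omega>
  have sub: "subalgebra P (G t)" for t using subalg sigma_finite_subalgebra.subalg by blast
  have sub2: "subalgebra (G t) (G s)" if "s \<le> t" for s t
    using sub[of s] sub[of t] G_mono[OF that] by (simp add: subalgebra_def)
  have I_meas: "I n \<in> borel_measurable (G n)" for n
    unfolding I_def using z_meas[of n] b_meas[of n] by measurable
  have X_meas: "X m \<in> borel_measurable (G n)" if "m < n" for m n
  proof -
    have [measurable]: "I m \<in> borel_measurable (G n)" "ys m \<in> borel_measurable (G n)"
      using measurable_from_subalg[OF sub2 I_meas[of m]] that y_meas[OF that] by simp_all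
    show ?thesis unfolding X_def by measurable
  qed
  have XP [measurable]: "X n \<in> borel_measurable P" for n
    using measurable_from_subalg[OF sub X_meas[of n "Suc n"]] by simp
  have yP [measurable]: "ys n \<in> borel_measurable P" for n
    using measurable_from_subalg[OF sub y_meas[of n "Suc n"]] by simp
  have X_bd: "\<bar>X n \<omega>\<bar> \<le> 1" for n \<omega>
    using y_binary[of n \<omega>] r by (auto simp: X_def I_def)
  have orth: "expectation (\<lambda>\<omega>. X m \<omega> * X n \<omega>) = 0" if mn: "m < n" for m n
  proof (cases "n \<le> t0")
    case False
    \<comment> \<open>The past term times the current indicator is \<open>G n\<close>-measurable, so
      it can be pulled out of the conditional expectation; where it is non-zero, the chosen pair is
      \<open>p\<close>.\<close>
    define U where "U \<omega> = X m \<omega> * I n \<omega>" for \<omega>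
    have U_G [measurable]: "U \<in> borel_measurable (G n)"
      using X_meas[OF mn] I_meas[of n] unfolding U_def by measurable
    have U_P [measurable]: "U \<in> borel_measurable P" by (rule measurable_from_subalg[OF sub U_G])
    have U_bd: "\<bar>U \<omega>\<bar> \<le> 1" for \<omega> using X_bd[of m \<omega>] by (auto simp: U_def I_def)
    have int1: "integrable P (\<lambda>\<omega>. U \<omega> * ys n \<omega>)"
    proof (rule integrable_const_bound[of _ 1])
      show "AE \<omega> in P. norm (U \<omega> * ys n \<omega>) \<le> 1"
      proof (rule AE_I2)
        show "norm (U \<omega> * ys n \<omega>) \<le> 1" for \<omega> using U_bd[of \<omega>] y_binary[of n \<omega>] by auto
      qed
    qed measurable
    have int2: "integrable P (\<lambda>\<omega>. U \<omega> * r)"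
    proof (rule integrable_const_bound[of _ 1])
      show "AE \<omega> in P. norm (U \<omega> * r) \<le> 1"
        using U_bd r by (intro AE_I2) (simp add: abs_mult mult_le_one)
    qed measurable
    have "(\<integral>\<omega>. U \<omega> * ys n \<omega> \<partial>P) = (\<integral>\<omega>. U \<omega> * real_cond_exp P (G n) (ys n) \<omega> \<partial>P)"
      by (rule sigma_finite_subalgebra.real_cond_exp_intg(2)[OF subalg int1 U_G yP, symmetric])
    also have "\<dots> = (\<integral>\<omega>. U \<omega> * r \<partial>P)"
    proof (rule integral_cong_AE)
      have "real_cond_exp P (G n) (ys n) \<in> borel_measurable P"
        by (rule measurable_from_subalg[OF sub borel_measurable_cond_exp])
      then show "(\<lambda>\<omega>. U \<omega> * real_cond_exp P (G n) (ys n) \<omega>) \<in> borel_measurable P" by measurable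
      have "AE \<omega> in P. real_cond_exp P (G n) (ys n) \<omega> = mu (bs n \<omega> * (\<theta>star \<bullet> zs n \<omega>))"
        using y_cond False by simp
      then show "AE \<omega> in P. U \<omega> * real_cond_exp P (G n) (ys n) \<omega> = U \<omega> * r"
        by eventually_elim (auto simp: U_def I_def r_def)
    qed measurable
    finally have "(\<integral>\<omega>. U \<omega> * ys n \<omega> - U \<omega> * r \<partial>P) = 0" using int1 int2 by simp
    moreover have "X m \<omega> * X n \<omega> = U \<omega> * ys n \<omega> - U \<omega> * r" for \<omega>
      using False by (simp add: U_def X_def[of n] algebra_simps)
    ultimately show ?thesis by simp
  qed (simp add: X_def)
  have "AE \<omega> in P. (\<lambda>n. (\<Sum>i<n. X i \<omega>) / real n) \<longlonglongrightarrow> 0"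
    by (rule strong_law_bounded_orthogonal[OF XP X_bd orth])
  then show ?thesis
  proof eventually_elim
    case (elim \<omega>)
    define g where "g s = (if (zs s \<omega>, bs s \<omega>) = p then ys s \<omega> - r else 0)" for s
    \<comment> \<open>The initial responses contribute a fixed amount on each path, which vanishes
      after division by \<open>T\<close>.\<close>
    define D where "D = (\<Sum>s\<in>{1..t0}. g s)"
    \<comment> \<open>The strong law sums over \<open>i < n\<close>; rounds up to \<open>T\<close>
      need \<open>n = Suc T\<close>, and the change of denominator is a factor tending to
      \<open>1\<close>.\<close>
    have "(\<lambda>T. (\<Sum>i<Suc T. X i \<omega>) / real (Suc T)) \<longlonglongrightarrow> 0" using LIMSEQ_Suc[OF elim] .
    moreover have "(\<lambda>T. real (Suc T) / real T) \<longlonglongrightarrow> 1" by (rule LIMSEQ_Suc_n_over_n)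
    ultimately have "(\<lambda>T. D / real T + (\<Sum>i<Suc T. X i \<omega>) / real (Suc T) * (real (Suc T) / real T)) \<longlonglongrightarrow> 0 + 0 * 1"
      by (intro tendsto_add tendsto_mult lim_const_over_n)
    then have lim: "(\<lambda>T. D / real T + (\<Sum>i<Suc T. X i \<omega>) / real (Suc T) * (real (Suc T) / real T)) \<longlonglongrightarrow> 0"
      by simp
    have "\<forall>\<^sub>F T in sequentially. D / real T + (\<Sum>i<Suc T. X i \<omega>) / real (Suc T) * (real (Suc T) / real T)
        = (\<Sum>s\<in>{1..T}. g s) / real T"
      using eventually_ge_at_top[of t0]
    proof eventually_elim
      case (elim T)
      have "(\<Sum>i<Suc T. X i \<omega>) = (\<Sum>i\<in>{Suc t0..T}. X i \<omega>)"
        by (rule sum.mono_neutral_right) (auto simp: X_def)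
      also have "\<dots> = (\<Sum>s\<in>{Suc t0..T}. g s)"
        by (intro sum.cong refl) (auto simp: X_def I_def g_def prod_eq_iff)
      finally have "D + (\<Sum>i<Suc T. X i \<omega>) = (\<Sum>s\<in>{1..t0} \<union> {Suc t0..T}. g s)"
        by (subst sum.union_disjoint) (auto simp: D_def)
      also have "{1..t0} \<union> {Suc t0..T} = {1..T}" using elim by auto
      finally have "D + (\<Sum>i<Suc T. X i \<omega>) = (\<Sum>s\<in>{1..T}. g s)" .
      moreover have "(\<Sum>i<Suc T. X i \<omega>) / real (Suc T) * (real (Suc T) / real T) = (\<Sum>i<Suc T. X i \<omega>) / real T"
        by (simp del: of_nat_Suc)
      ultimately show ?case by (simp only: add_divide_distrib[symmetric])
    qed
    from Lim_transform_eventually[OF lim this] show ?case unfolding g_def r_def .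
  qed
qed

theorem theoremS:
  fixes \<phi> :: "'c \<Rightarrow> 'act \<Rightarrow> real^'d"
    and n :: nat and xs :: "nat \<Rightarrow> 'c" and a0 a1 :: "nat \<Rightarrow> 'act"
    and Z :: "(real^'d) set"
    and g :: nat and k :: "real^'d \<Rightarrow> nat"
    and m :: nat and beta :: "nat \<Rightarrow> nat \<Rightarrow> real"  \<comment> \<open>beta j c = rationality of teacher j on category c\<close>
    and \<Theta> :: "(real^'d) set" and \<theta>star :: "real^'d"
    and \<xi>star :: "(real^'d) \<times> real \<Rightarrow> real"
    and C\<theta> C\<beta> C\<phi> :: real
    and P :: "'o measure" and G :: "nat \<Rightarrow> 'o measure"
    and zs :: "nat \<Rightarrow> 'o \<Rightarrow> real^'d" and bs :: "nat \<Rightarrow> 'o \<Rightarrow> real"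
    and ys :: "nat \<Rightarrow> 'o \<Rightarrow> real" and th :: "nat \<Rightarrow> 'o \<Rightarrow> real^'d"
    and t0 :: nat
    and Bk :: "nat \<Rightarrow> real set" and B :: "real set"
    and Fs :: "((real^'d) \<times> real) set"
  assumes Bk_def: "\<forall>c. Bk c = {beta j c | j. j \<in> {1..m}}"
    and B_def: "B = (\<Union>c\<in>{1..g}. Bk c)"
    and Fs_def: "Fs = feasible Z k Bk"
    and Z_def: "Z = {\<phi> (xs i) (a1 i) - \<phi> (xs i) (a0 i) | i. i \<in> {1..n}}"
    and cat: "\<forall>z\<in>Z. k z \<in> {1..g}"
    and m_pos: "m \<ge> 1"
    and beta_pos: "\<forall>j\<in>{1..m}. \<forall>c\<in>{1..g}. beta j c > 0"
    and Theta_compact: "compact \<Theta>" and theta_star_in: "\<theta>star \<in> \<Theta>"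
    \<comment> \<open>D-optimal design\<close>
    and xi_design: "is_design Fs \<xi>star"
    and xi_opt: "\<forall>\<xi>. is_design Fs \<xi> \<longrightarrow>
                   det (info_matrix Fs \<xi> \<theta>star) \<le> det (info_matrix Fs \<xi>star \<theta>star)"
    \<comment> \<open>Assumption 1\<close>
    and A1: "posdef (info_matrix Fs \<xi>star \<theta>star)"
    \<comment> \<open>Assumption 2\<close>
    and A2_theta: "C\<theta> > 0" "\<forall>\<theta>\<in>\<Theta>. norm \<theta> \<le> C\<theta>"
    and A2_beta: "C\<beta> > 0" "\<forall>b\<in>B. \<bar>b\<bar> < C\<beta>"
    and A2_phi: "C\<phi> > 0" "\<forall>x a. norm (\<phi> x a) \<le> C\<phi>"
    and A2_ident: "\<forall>\<theta>\<in>\<Theta>. (\<forall>z\<in>Z. \<forall>b\<in>Bk (k z). mu (b * (\<theta> \<bullet> z)) = mu (b * (\<theta>star \<bullet> z)))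
                      \<longrightarrow> \<theta> = \<theta>star"
    \<comment> \<open>probabilistic setting; G t = information available just before y_t is observed\<close>
    and prob: "prob_space P"
    and subalg: "\<forall>t. sigma_finite_subalgebra P (G t)"
    and G_mono: "\<forall>s t. s \<le> t \<longrightarrow> sets (G s) \<subseteq> sets (G t)"
    and y_binary: "\<forall>t \<omega>. ys t \<omega> \<in> {0, 1}"
    and y_meas: "\<forall>s t. s < t \<longrightarrow> ys s \<in> borel_measurable (G t)"
    and zb_meas: "\<forall>t. zs t \<in> borel_measurable (G t) \<and> bs t \<in> borel_measurable (G t)"
    and y_cond: "\<forall>t>t0. AE \<omega> in P. real_cond_exp P (G t) (ys t) \<omega> = mu (bs t \<omega> * (\<theta>star \<bullet> zs t \<omega>))"
    \<comment> \<open>the algorithm\<close>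
    and t0_pos: "t0 \<ge> 1"
    and feas: "\<forall>t\<ge>1. \<forall>\<omega>. (zs t \<omega>, bs t \<omega>) \<in> Fs"
    and init_pd: "\<forall>\<omega>. \<forall>\<theta>\<in>\<Theta>. posdef (info_matrix Fs (emp_design (\<lambda>s. (zs s \<omega>, bs s \<omega>)) t0) \<theta>)"
    and init_est: "\<forall>\<omega>. th t0 \<omega> \<in> \<Theta>"
    and select: "\<forall>t>t0. \<forall>\<omega>. \<forall>p\<in>Fs.
        det (Hmat (\<lambda>s. zs s \<omega>) (\<lambda>s. bs s \<omega>) (t - 1) (th (t - 1) \<omega>)
             + (mudot (snd p * (th (t - 1) \<omega> \<bullet> fst p)) * (snd p)^2) *\<^sub>R outer (fst p))
        \<le> det (Hmat (\<lambda>s. zs s \<omega>) (\<lambda>s. bs s \<omega>) (t - 1) (th (t - 1) \<omega>)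
             + (mudot (bs t \<omega> * (th (t - 1) \<omega> \<bullet> zs t \<omega>)) * (bs t \<omega>)^2) *\<^sub>R outer (zs t \<omega>))"
    and mle: "\<forall>t>t0. \<forall>\<omega>. th t \<omega> \<in> \<Theta> \<and>
        (\<forall>\<theta>\<in>\<Theta>. loglik (\<lambda>s. zs s \<omega>) (\<lambda>s. bs s \<omega>) (\<lambda>s. ys s \<omega>) t \<theta>
                 \<le> loglik (\<lambda>s. zs s \<omega>) (\<lambda>s. bs s \<omega>) (\<lambda>s. ys s \<omega>) t (th t \<omega>))"
  shows "AE \<omega> in P. (\<lambda>T. info_matrix Fs (emp_design (\<lambda>s. (zs s \<omega>, bs s \<omega>)) T) (th T \<omega>))
            \<longlonglongrightarrow> info_matrix Fs \<xi>star \<theta>star"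
proof -
  have finZ: "finite Z"
    unfolding Z_def by (simp add: setcompr_eq_image)
  have "Fs = Sigma Z (\<lambda>z. Bk (k z))" unfolding Fs_def feasible_def by auto
  moreover have finB: "finite (Bk c)" for c
    using Bk_def by (simp add: setcompr_eq_image)
  ultimately have finFs: "finite Fs" using finZ by simp
  have snd_pos: "snd p > 0" if pF: "p \<in> Fs" for p
  proof -
    obtain z b where p: "p = (z, b)" "z \<in> Z" "b \<in> Bk (k z)"
      using pF unfolding Fs_def feasible_def by blast
    obtain j where "b = beta j (k z)" "j \<in> {1..m}" using p(3) Bk_def by auto
    then show ?thesis using beta_pos cat p by simp
  qed
  \<comment> \<open>A common bound for all linear predictors over \<open>\<Theta>\<close>; the sum
    of non-negative terms dominates each of them.\<close>
  define X where "X = (\<Sum>p\<in>Fs. \<bar>snd p\<bar> * (C\<theta> * norm (fst p)))"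
  have X_bound: "\<bar>snd p * (\<theta> \<bullet> fst p)\<bar> \<le> X" if "p \<in> Fs" "\<theta> \<in> \<Theta>" for p \<theta>
  proof -
    have "\<bar>snd p * (\<theta> \<bullet> fst p)\<bar> \<le> \<bar>snd p\<bar> * (norm \<theta> * norm (fst p))"
      by (simp add: abs_mult mult_left_mono Cauchy_Schwarz_ineq2)
    also have "\<dots> \<le> \<bar>snd p\<bar> * (C\<theta> * norm (fst p))"
      using A2_theta that by (intro mult_left_mono mult_right_mono) auto
    also have "\<dots> \<le> X"
      unfolding X_def using finFs that A2_theta by (intro member_le_sum) auto
    finally show ?thesis .
  qed
  \<comment> \<open>Finitely many design points allow a single null set for all noise
    averages.\<close>
  have "AE \<omega> in P. \<forall>p\<in>Fs. (\<lambda>T. (\<Sum>s\<in>{1..T}. if (zs s \<omega>, bs s \<omega>) = p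
      then ys s \<omega> - mu (snd p * (\<theta>star \<bullet> fst p)) else 0) / real T) \<longlonglongrightarrow> 0"
    by (intro AE_finite_allI[OF finFs] noise_average_tendsto_zero[OF prob, of G _ _ _ t0])
      (use subalg G_mono y_binary y_meas zb_meas y_cond in auto)
  then show ?thesis
  proof eventually_elim
    case (elim \<omega>)
    show ?case
    proof (rule adaptive_design_converges[where \<Theta>=\<Theta> and X=X and y="\<lambda>s. ys s \<omega>" and ?t0.0=t0])
      \<comment> \<open>Index shift: the rule for round \<open>Suc t\<close> uses the estimate after
        \<open>t\<close> rounds.\<close>
      show "det (Hmat (\<lambda>s. zs s \<omega>) (\<lambda>s. bs s \<omega>) t (th t \<omega>) + logistic_weight (th t \<omega>) p *\<^sub>R outer (fst p))
        \<le> det (Hmat (\<lambda>s. zs s \<omega>) (\<lambda>s. bs s \<omega>) t (th t \<omega>)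
          + logistic_weight (th t \<omega>) (zs (Suc t) \<omega>, bs (Suc t) \<omega>) *\<^sub>R outer (zs (Suc t) \<omega>))"
        if "t \<ge> t0" "p \<in> Fs" for t p
        using select[rule_format, of "Suc t" p \<omega>] that by simp
      show "th t \<omega> \<in> \<Theta>" if "t \<ge> t0" for t
        using that mle init_est by (cases "t = t0") auto
    qed (use finFs snd_pos X_bound theta_star_in feas t0_pos init_pd mle elim xi_design xi_opt A1 in auto)
  qed
qed

end
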